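(* Let $\tau_0=i/\sqrt3$. Then $$\phi(\tau_0)=\frac{\sqrt3}{2\pi}\cdot\frac{1}{2^{1/3}}\,B(1/3,1/3)\qquad\text{and}\qquad \phi_1(\tau_0)=\frac{1}{2^{2/3}\cdot3^{1/2}}\cdot\frac{1}{2\pi}\,B(1/3,1/3).$$
   Context: Let $q^r=e^{2\pi ir\tau}$ for $\tau$ in the upper half-plane. $\theta_2(\tau)=\sum_{n\in\mathbb{Z}}q^{(2n+1)^2/8}$ and $\theta_3(\tau)=\sum_{n\in\mathbb{Z}}q^{n^2/2}$. Define $\phi(\tau)=\theta_2(2\tau)\theta_2(6\tau)+\theta_3(2\tau)\theta_3(6\tau)$ and $\phi_1(\tau)=\frac16\big(\phi(\tau/3)-\phi(\tau)\big)$. $B(a,b)=\Gamma(a)\Gamma(b)/\Gamma(a+b)$ is the beta function. *)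

theory Defs
  imports "HOL-Analysis.Analysis"
begin

definition qpow :: "complex \<Rightarrow> real \<Rightarrow> complex" where
  "qpow \<tau> r = exp (2 * pi * \<i> * of_real r * \<tau>)"

definition theta2 :: "complex \<Rightarrow> complex" where
  "theta2 \<tau> = (\<Sum>\<^sub>\<infinity>n::int. qpow \<tau> ((2 * of_int n + 1)^2 / 8))"

definition theta3 :: "complex \<Rightarrow> complex" where
  "theta3 \<tau> = (\<Sum>\<^sub>\<infinity>n::int. qpow \<tau> ((of_int n)^2 / 2))"

definition phi :: "complex \<Rightarrow> complex" where
  "phi \<tau> = theta2 (2 * \<tau>) * theta2 (6 * \<tau>) + theta3 (2 * \<tau>) * theta3 (6 * \<tau>)"

definition phi1 :: "complex \<Rightarrow> complex" where
  "phi1 \<tau> = (phi (\<tau> / 3) - phi \<tau>) / 6"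

end

theory Submission
  imports Defs
begin

text \<open>
  On the imaginary axis \<open>phi\<close> is the theta series of the Eisenstein integers, the Borwein function
  \<open>a\<close>, and \<open>phi1\<close> is \<open>c / 3\<close>.

  Write \<open>F(a, b)\<close> for the integral of \<open>1 / sqrt ((t\<^sup>2 + a\<^sup>2) (t\<^sup>2 + b\<^sup>2))\<close> over the real line. It is
  invariant under the arithmetic-geometric mean, and doubling the exponent performs one AGM step on
  squares of theta constants. Iterating gives \<open>F(\<theta>\<^sub>3\<^sup>2, \<theta>\<^sub>4\<^sup>2) = \<pi>\<close> and, through the logarithmic behaviour of
  \<open>F(1, e)\<close> at \<open>e = 0\<close>, also \<open>F(\<theta>\<^sub>3\<^sup>2, \<theta>\<^sub>2\<^sup>2) = s\<close> at nome \<open>exp (- s)\<close>; as \<open>F(1, k)\<close> strictly decreases in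
  \<open>k\<close>, these two values force the inversion \<open>s \<mapsto> \<pi>\<^sup>2 / s\<close> without Poisson summation. With the modular
  equation of degree 3 this gives \<open>k k' = 1/4\<close> at \<open>s = \<pi> sqrt 3\<close>, where \<open>F(1, k')\<close> is an integral of
  \<open>(x\<^sup>3 - 1)\<^bsup>-1/2\<^esup>\<close>, hence a beta value. Finally \<open>a\<^sup>3 = b\<^sup>3 + c\<^sup>3\<close>, and inversion gives \<open>b = c\<close> at the
  point in question, so that \<open>c = a / 2\<^bsup>1/3\<^esup>\<close>.
\<close>

section \<open>Theta constants\<close>

lemma has_sum_Times_mult:
  fixes f :: "'a \<Rightarrow> real" and g :: "'b \<Rightarrow> real"
  assumes "(f has_sum a) A" "(g has_sum b) B"
  shows "((\<lambda>(x, y). f x * g y) has_sum (a * b)) (A \<times> B)"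
proof (rule has_sum_SigmaI)
  show "((\<lambda>y. case (x, y) of (x, y) \<Rightarrow> f x * g y) has_sum f x * b) B" for x
    using has_sum_cmult_right[OF assms(2), of "f x"] by simp
  show "((\<lambda>x. f x * b) has_sum a * b) A"
    using has_sum_cmult_left[OF assms(1), of b] by simp
  \<comment> \<open>Real summability is absolute, so the product family is summable; this is what
    allows the iterated evaluation.\<close>
  have "(\<lambda>x. norm (f x)) summable_on A" "(\<lambda>y. norm (g y)) summable_on B"
    using assms summable_on_iff_abs_summable_on_real has_sum_imp_summable by blast+
  hence "(\<lambda>p. norm (case p of (x, y) \<Rightarrow> f x * g y)) summable_on A \<times> B"
    by (subst Infinite_Sum.abs_summable_on_Sigma_iff)
      (auto simp: abs_mult summable_on_cmult_right summable_on_cmult_left infsum_cmult_right'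
        intro!: infsum_nonneg)
  thus "(\<lambda>(x, y). f x * g y) summable_on A \<times> B"
    using summable_on_iff_abs_summable_on_real by blast
qed

lemma gauss_summable:
  assumes "s > (0::real)"
  shows "(\<lambda>n::int. exp (- (s * (of_int n + c)\<^sup>2))) summable_on UNIV"
proof -
  define r where "r = exp (- (s / 2))"
  have "(\<lambda>n::nat. r ^ n) summable_on UNIV"
    using assms by (intro norm_summable_imp_summable_on) (auto simp: r_def summable_geometric)
  moreover have "(\<lambda>n::nat. r ^ n) summable_on UNIV \<longleftrightarrow> (\<lambda>n::int. r ^ nat \<bar>n\<bar>) summable_on {0..}"
    by (rule summable_on_reindex_bij_witness[of _ nat int]) auto
  moreover have "(\<lambda>n::nat. r ^ n) summable_on UNIV \<longleftrightarrow> (\<lambda>n::int. r ^ nat \<bar>n\<bar>) summable_on {..0}"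
    by (rule summable_on_reindex_bij_witness[of _ "\<lambda>n. nat (- n)" "\<lambda>n. - int n"]) auto
  ultimately have "(\<lambda>n::int. r ^ nat \<bar>n\<bar>) summable_on ({0..} \<union> {..0})"
    using summable_on_union by blast
  moreover have "{0..} \<union> {..0} = (UNIV :: int set)" by auto
  ultimately have "(\<lambda>n::int. exp (s * c\<^sup>2) * r ^ nat \<bar>n\<bar>) summable_on UNIV"
    using summable_on_cmult_right by metis
  thus ?thesis
  proof (rule summable_on_comparison_test)
    fix n :: int
    have "real_of_int \<bar>n\<bar> \<le> real_of_int (n * n)"
      using abs_le_square_iff[of 1 n] int_one_le_iff_zero_less[of "\<bar>n\<bar>"] self_le_power[of "\<bar>n\<bar>" 2]
      by (cases "n = 0") (auto simp: power2_eq_square simp del: of_int_mult of_int_abs)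
    \<comment> \<open>This square arises from
      \<open>2 (n + c)^2 = n^2 + (n + 2 c)^2 - 2 c^2\<close>.\<close>
    moreover have "0 \<le> (of_int n + 2 * c)\<^sup>2" by simp
    ultimately have "\<bar>of_int n\<bar> / 2 - c\<^sup>2 \<le> (of_int n + c)\<^sup>2"
      by (simp add: power2_eq_square algebra_simps)
    hence "s * (\<bar>of_int n\<bar> / 2 - c\<^sup>2) \<le> s * (of_int n + c)\<^sup>2"
      using assms by (intro mult_left_mono) auto
    hence "exp (- (s * (of_int n + c)\<^sup>2)) \<le> exp (s * c\<^sup>2 + \<bar>of_int n\<bar> * (- (s / 2)))"
      by (simp add: algebra_simps)
    also have "\<dots> = exp (s * c\<^sup>2) * r ^ nat \<bar>n\<bar>"
      by (simp add: exp_add r_def mult_ac flip: exp_of_nat_mult exp_add)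
    finally show "exp (- (s * (of_int n + c)\<^sup>2)) \<le> exp (s * c\<^sup>2) * r ^ nat \<bar>n\<bar>" .
  qed auto
qed

text \<open>The Jacobi theta constants at nome \<open>exp (- s)\<close>, that is at
  \<open>\<tau> = i s / \<pi>\<close>.\<close>

definition th2 :: "real \<Rightarrow> real" where
  "th2 s = (\<Sum>\<^sub>\<infinity>n::int. exp (- (s * (of_int n + 1/2)\<^sup>2)))"

definition th3 :: "real \<Rightarrow> real" where
  "th3 s = (\<Sum>\<^sub>\<infinity>n::int. exp (- (s * (of_int n)\<^sup>2)))"

definition th4 :: "real \<Rightarrow> real" where
  "th4 s = (\<Sum>\<^sub>\<infinity>n::int. (if even n then 1 else -1) * exp (- (s * (of_int n)\<^sup>2)))"

lemma has_sum_th2: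
  "s > 0 \<Longrightarrow> ((\<lambda>n::int. exp (- (s * (of_int n + 1/2)\<^sup>2))) has_sum th2 s) UNIV"
  unfolding th2_def by (intro has_sum_infsum gauss_summable)

lemma has_sum_th3:
  "s > 0 \<Longrightarrow> ((\<lambda>n::int. exp (- (s * (of_int n)\<^sup>2))) has_sum th3 s) UNIV"
  unfolding th3_def using gauss_summable[of s 0] by (intro has_sum_infsum) simp

lemma has_sum_th4:
  assumes "s > 0"
  shows "((\<lambda>n::int. (if even n then 1 else -1) * exp (- (s * (of_int n)\<^sup>2))) has_sum th4 s) UNIV"
proof -
  have "(\<lambda>n::int. exp (- (s * (of_int n)\<^sup>2))) summable_on UNIV"
    using gauss_summable[OF assms, of 0] by simp
  hence "(\<lambda>n::int. norm ((if even n then 1 else -1) * exp (- (s * (of_int n)\<^sup>2)))) summable_on UNIV"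
    by (rule back_subst[of "\<lambda>f. f summable_on UNIV"]) auto
  thus ?thesis
    unfolding th4_def using summable_on_iff_abs_summable_on_real by (intro has_sum_infsum) blast
qed

section \<open>Parity splittings and duplication formulas\<close>

lemma has_sum_even_int:
  "(f has_sum a) {n::int. even n} \<longleftrightarrow> ((\<lambda>k. f (2 * k)) has_sum a) UNIV"
  by (rule has_sum_reindex_bij_witness[of _ "\<lambda>k. 2 * k" "\<lambda>n. n div 2"]) auto

lemma has_sum_odd_int:
  "(f has_sum a) {n::int. odd n} \<longleftrightarrow> ((\<lambda>k. f (2 * k + 1)) has_sum a) UNIV"
  by (rule has_sum_reindex_bij_witness[of _ "\<lambda>k. 2 * k + 1" "\<lambda>n. n div 2"]) auto

lemma UNIV_parity: "UNIV = {n::int. even n} \<union> {n. odd n}"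
  by auto

lemma has_sum_th3_even:
  assumes "s > 0"
  shows "((\<lambda>n::int. exp (- (s * (of_int n)\<^sup>2))) has_sum th3 (4 * s)) {n. even n}"
  using has_sum_th3[of "4 * s"] assms
  by (simp add: has_sum_even_int power_mult_distrib mult_ac)

lemma has_sum_th3_odd:
  assumes "s > 0"
  shows "((\<lambda>n::int. exp (- (s * (of_int n)\<^sup>2))) has_sum th2 (4 * s)) {n. odd n}"
proof -
  have "s * (of_int (2 * k + 1))\<^sup>2 = 4 * s * (of_int k + 1/2)\<^sup>2" for k
    by (simp add: power2_eq_square algebra_simps)
  hence "(\<lambda>k. exp (- (s * (of_int (2 * k + 1))\<^sup>2))) = (\<lambda>k. exp (- (4 * s * (of_int k + 1/2)\<^sup>2)))"
    by presburger
  thus ?thesis unfolding has_sum_odd_int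
    using has_sum_th2[of "4 * s"] assms by simp
qed

lemma th3_split: "s > 0 \<Longrightarrow> th3 s = th3 (4 * s) + th2 (4 * s)"
  using has_sum_Un_disjoint[OF has_sum_th3_even has_sum_th3_odd, of s] has_sum_th3[of s]
  by (auto simp flip: UNIV_parity dest: has_sum_unique)

lemma th4_split:
  assumes "s > 0"
  shows "th4 s = th3 (4 * s) - th2 (4 * s)"
proof -
  let ?f = "\<lambda>n::int. (if even n then 1 else -1) * exp (- (s * (of_int n)\<^sup>2))"
  have "(?f has_sum th3 (4 * s)) {n. even n}"
    using has_sum_th3_even[OF assms] by (rule has_sum_cong[THEN iffD1, rotated]) auto
  moreover have "(?f has_sum - th2 (4 * s)) {n. odd n}"
    using has_sum_th3_odd[OF assms, THEN has_sum_uminusI]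
    by (rule has_sum_cong[THEN iffD1, rotated]) auto
  ultimately have "(?f has_sum (th3 (4 * s) + - th2 (4 * s))) UNIV"
    unfolding UNIV_parity by (rule has_sum_Un_disjoint) auto
  thus ?thesis
    using has_sum_th4[OF assms] has_sum_unique by fastforce
qed

lemma UNIV_parity_sum:
  "UNIV \<times> UNIV = {(m, n). even (m + n)} \<union> {(m::int, n::int). odd (m + n)}"
  by auto

text \<open>The points with \<open>m + n\<close> even form a copy of the integer lattice, rotated by
  45 degrees and stretched by \<open>sqrt 2\<close>:
  \<open>(k + l)^2 + (k - l)^2 = 2 (k^2 + l^2)\<close>. This doubles the exponent in squares of
  theta constants. For \<open>m + n\<close> odd, the same rotation leads to half-integers and hence
  to \<open>th2\<close>.\<close>

lemma has_sum_even_sum: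
  "(f has_sum a) {(m::int, n::int). even (m + n)} \<longleftrightarrow>
    ((\<lambda>(k, l). f (k + l, k - l)) has_sum a) (UNIV \<times> UNIV)"
proof (rule has_sum_reindex_bij_witness[of _ "\<lambda>(k, l). (k + l, k - l)"
        "\<lambda>(m, n). ((m + n) div 2, (m - n) div 2)"])
  fix p :: "int \<times> int" assume "p \<in> {(m, n). even (m + n)}"
  then obtain m n where p: "p = (m, n)" "even (m + n)" by blast
  then have "(m + n) div 2 + (m - n) div 2 = m" "(m + n) div 2 - (m - n) div 2 = n"
    by presburger+
  then show "(case case p of (m, n) \<Rightarrow> ((m + n) div 2, (m - n) div 2) of (k, l) \<Rightarrow> (k + l, k - l)) = p"
    "(case case p of (m, n) \<Rightarrow> ((m + n) div 2, (m - n) div 2) of (k, l) \<Rightarrow> f (k + l, k - l)) = f p"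
    by (auto simp: p)
qed auto

lemma has_sum_odd_sum:
  "(f has_sum a) {(m::int, n::int). odd (m + n)} \<longleftrightarrow>
    ((\<lambda>(k, l). f (k + l + 1, k - l)) has_sum a) (UNIV \<times> UNIV)"
proof (rule has_sum_reindex_bij_witness[of _ "\<lambda>(k, l). (k + l + 1, k - l)"
        "\<lambda>(m, n). ((m + n) div 2, (m - n) div 2)"])
  fix p :: "int \<times> int" assume "p \<in> {(m, n). odd (m + n)}"
  then obtain m n where p: "p = (m, n)" "odd (m + n)" by blast
  then have "(m + n) div 2 + (m - n) div 2 + 1 = m" "(m + n) div 2 - (m - n) div 2 = n"
    by presburger+
  then show "(case case p of (m, n) \<Rightarrow> ((m + n) div 2, (m - n) div 2) of (k, l) \<Rightarrow> (k + l + 1, k - l)) = p"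
    "(case case p of (m, n) \<Rightarrow> ((m + n) div 2, (m - n) div 2) of (k, l) \<Rightarrow> f (k + l + 1, k - l)) = f p"
    by (auto simp: p)
qed auto

lemma th3_square_aux:
  assumes "s > 0"
  shows "((\<lambda>(m::int, n::int). exp (- (s * (of_int m)\<^sup>2)) * exp (- (s * (of_int n)\<^sup>2)))
           has_sum (th3 (2 * s))\<^sup>2) {(m, n). even (m + n)}" (is "(?f has_sum _) ?A")
    and "((\<lambda>(m::int, n::int). exp (- (s * (of_int m)\<^sup>2)) * exp (- (s * (of_int n)\<^sup>2)))
           has_sum (th2 (2 * s))\<^sup>2) {(m, n). odd (m + n)}" (is "(?f has_sum _) ?B")
proof -
  have s2: "2 * s > 0" using assms by simp
  show "(?f has_sum (th3 (2 * s))\<^sup>2) ?A"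
    using has_sum_Times_mult[OF has_sum_th3 has_sum_th3, OF s2 s2]
    unfolding has_sum_even_sum power2_eq_square[of "th3 (2 * s)"]
    by (rule has_sum_cong[THEN iffD1, rotated])
      (auto simp: power2_eq_square algebra_simps simp flip: exp_add)
  show "(?f has_sum (th2 (2 * s))\<^sup>2) ?B"
    using has_sum_Times_mult[OF has_sum_th2 has_sum_th2, OF s2 s2]
    unfolding has_sum_odd_sum power2_eq_square[of "th2 (2 * s)"]
    by (rule has_sum_cong[THEN iffD1, rotated])
      (auto simp: power2_eq_square algebra_simps simp flip: exp_add)
qed

lemma th3_square:
  assumes "s > 0"
  shows "(th3 s)\<^sup>2 = (th3 (2 * s))\<^sup>2 + (th2 (2 * s))\<^sup>2"
proof -
  have "((\<lambda>(m::int, n::int). exp (- (s * (of_int m)\<^sup>2)) * exp (- (s * (of_int n)\<^sup>2)))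
           has_sum ((th3 (2 * s))\<^sup>2 + (th2 (2 * s))\<^sup>2)) (UNIV \<times> UNIV)"
    unfolding UNIV_parity_sum by (rule has_sum_Un_disjoint[OF th3_square_aux[OF assms]]) auto
  thus ?thesis
    using has_sum_Times_mult[OF has_sum_th3[OF assms] has_sum_th3[OF assms]] has_sum_unique
    unfolding power2_eq_square[of "th3 s"] by blast
qed

lemma th4_square:
  assumes "s > 0"
  shows "(th4 s)\<^sup>2 = (th3 (2 * s))\<^sup>2 - (th2 (2 * s))\<^sup>2"
proof -
  let ?e = "\<lambda>n::int. (if even n then 1 else -1) * exp (- (s * (of_int n)\<^sup>2))"
  have "((\<lambda>(m, n). ?e m * ?e n) has_sum (th3 (2 * s))\<^sup>2) {(m, n). even (m + n)}"
    using th3_square_aux(1)[OF assms] by (rule has_sum_cong[THEN iffD1, rotated]) auto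
  moreover have "((\<lambda>(m, n). ?e m * ?e n) has_sum - (th2 (2 * s))\<^sup>2) {(m, n). odd (m + n)}"
    using th3_square_aux(2)[OF assms, THEN has_sum_uminusI]
    by (rule has_sum_cong[THEN iffD1, rotated]) auto
  ultimately have "((\<lambda>(m, n). ?e m * ?e n) has_sum ((th3 (2 * s))\<^sup>2 + - (th2 (2 * s))\<^sup>2)) (UNIV \<times> UNIV)"
    unfolding UNIV_parity_sum by (rule has_sum_Un_disjoint) auto
  thus ?thesis
    using has_sum_Times_mult[OF has_sum_th4[OF assms] has_sum_th4[OF assms]] has_sum_unique
    unfolding power2_eq_square[of "th4 s"] by fastforce
qed

text \<open>A difference of squares at \<open>4 s\<close>, factored by the parity splittings. With
  \<open>th3_square\<close> and \<open>th4_square\<close>, doubling \<open>s\<close> becomes one AGM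
  step on \<open>th3^2\<close> and \<open>th4^2\<close>.\<close>

lemma th4_double:
  assumes "s > 0"
  shows "(th4 (2 * s))\<^sup>2 = th3 s * th4 s"
proof -
  have "2 * (2 * s) = 4 * s" by simp
  hence "(th4 (2 * s))\<^sup>2 = (th3 (4 * s))\<^sup>2 - (th2 (4 * s))\<^sup>2"
    using th4_square[of "2 * s"] assms by simp
  also have "\<dots> = th3 s * th4 s"
    unfolding th3_split[OF assms] th4_split[OF assms] by (simp add: power2_eq_square algebra_simps)
  finally show ?thesis .
qed

text \<open>Compares two evaluations of \<open>th3 (s / 2)^2 - th4 (s / 2)^2\<close>, one from the
  squaring formulas and one from the parity splittings.\<close>

lemma th2_square:
  assumes "s > 0"
  shows "(th2 s)\<^sup>2 = 2 * th3 (2 * s) * th2 (2 * s)"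
  using th4_square[of "s / 2"] th3_square[of "s / 2"] th3_split[of "s / 2"] th4_split[of "s / 2"] assms
  by (simp add: power2_eq_square algebra_simps)

text \<open>Jacobi's quartic identity is \<open>(A + B)^2 = (A - B)^2 + 4 A B\<close> for
  \<open>A = th3 (2 s)^2\<close> and \<open>B = th2 (2 s)^2\<close>.\<close>

lemma th_quartic:
  assumes "s > 0"
  shows "(th3 s) ^ 4 = (th4 s) ^ 4 + (th2 s) ^ 4"
proof -
  have *: "x ^ 4 = (x\<^sup>2)\<^sup>2" for x :: real by simp
  show ?thesis
    unfolding * th2_square[OF assms] th3_square[OF assms] th4_square[OF assms]
    by (simp add: power2_eq_square algebra_simps)
qed

section \<open>The modular equation of degree 3\<close>

lemma th_cubic_modular_aux:
  assumes "s > 0"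
  shows "((\<lambda>(m::int, n::int). exp (- (s * (of_int m)\<^sup>2)) * exp (- (3 * s * (of_int n)\<^sup>2)))
           has_sum (th2 s * th2 (3 * s) / 2)) {(m, n). odd (m + n)}" (is "(?f has_sum _) ?O")
proof -
  let ?g = "\<lambda>(m::int, n::int). exp (- (s * (of_int m + 1/2)\<^sup>2)) * exp (- (3 * s * (of_int n + 1/2)\<^sup>2))"
  have g: "(?g has_sum (th2 s * th2 (3 * s))) (UNIV \<times> UNIV)"
    using assms by (intro has_sum_Times_mult has_sum_th2) auto
  have "(?f has_sum (th3 s * th3 (3 * s))) (UNIV \<times> UNIV)"
    using assms by (intro has_sum_Times_mult has_sum_th3) auto
  hence "?f summable_on ?O"
    by (rule summable_on_subset[OF has_sum_imp_summable]) auto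
  then obtain a where a: "(?f has_sum a) ?O"
    using summable_on_def by blast
  have "(?f has_sum a) ?O \<longleftrightarrow> ((\<lambda>(k, l). ?f (k + 2 * l + 1, k)) has_sum a) (UNIV \<times> UNIV)"
  proof (rule has_sum_reindex_bij_witness[of _ "\<lambda>(k, l). (k + 2 * l + 1, k)" "\<lambda>(m, n). (n, (m - n) div 2)"])
    fix p assume "p \<in> ?O"
    then obtain m n where p: "p = (m, n)" "odd (m + n)" by blast
    then have "n + 2 * ((m - n) div 2) + 1 = m" by presburger
    then show "(case case p of (m, n) \<Rightarrow> (n, (m - n) div 2) of (k, l) \<Rightarrow> (k + 2 * l + 1, k)) = p"
      "(case case p of (m, n) \<Rightarrow> (n, (m - n) div 2) of (k, l) \<Rightarrow> ?f (k + 2 * l + 1, k)) = ?f p"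
      by (simp_all only: p prod.case)
  qed auto
  with a have a: "((\<lambda>(k, l). ?f (k + 2 * l + 1, k)) has_sum a) (UNIV \<times> UNIV)" by blast
  \<comment> \<open>The first equation is an isometry of \<open>m^2 + 3 n^2\<close>: conjugation of
    \<open>m + n sqrt (-3)\<close> followed by multiplication by the sixth root of unity
    \<open>(1 + sqrt (-3)) / 2\<close>. The second adds the reflection
    \<open>l \<mapsto> - 1 - l\<close>, which negates \<open>l + 1/2\<close>. The two images are the
    half-integer points of either parity, so each parity carries half of the \<open>th2\<close>
    product.\<close>
  have eqs: "?f (k + 2 * l + 1, k) = ?g (l + 2 * k, l)" "?f (k + 2 * l + 1, k) = ?g (l + 2 * k, - 1 - l)" for k l
    by (simp_all add: power2_eq_square algebra_simps flip: exp_add)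
  have "(?g has_sum a) {(m, n). even (m + n)} \<longleftrightarrow> ((\<lambda>(k, l). ?g (l + 2 * k, l)) has_sum a) (UNIV \<times> UNIV)"
  proof (rule has_sum_reindex_bij_witness[of _ "\<lambda>(k, l). (l + 2 * k, l)" "\<lambda>(m, n). ((m - n) div 2, n)"])
    fix p :: "int \<times> int" assume "p \<in> {(m, n). even (m + n)}"
    then obtain m n where p: "p = (m, n)" "even (m + n)" by blast
    then have "n + 2 * ((m - n) div 2) = m" by presburger
    then show "(case case p of (m, n) \<Rightarrow> ((m - n) div 2, n) of (k, l) \<Rightarrow> (l + 2 * k, l)) = p"
      "(case case p of (m, n) \<Rightarrow> ((m - n) div 2, n) of (k, l) \<Rightarrow> ?g (l + 2 * k, l)) = ?g p"
      by (simp_all only: p prod.case)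
  qed auto
  with a have 1: "(?g has_sum a) {(m, n). even (m + n)}" unfolding eqs(1) by blast
  have "(?g has_sum a) {(m, n). odd (m + n)} \<longleftrightarrow> ((\<lambda>(k, l). ?g (l + 2 * k, - 1 - l)) has_sum a) (UNIV \<times> UNIV)"
  proof (rule has_sum_reindex_bij_witness[of _ "\<lambda>(k, l). (l + 2 * k, - 1 - l)" "\<lambda>(m, n). ((m + n + 1) div 2, - 1 - n)"])
    fix p :: "int \<times> int" assume "p \<in> {(m, n). odd (m + n)}"
    then obtain m n where p: "p = (m, n)" "odd (m + n)" by blast
    then have "- 1 - n + 2 * ((m + n + 1) div 2) = m" "- 1 - (- 1 - n) = n" by presburger+
    then show "(case case p of (m, n) \<Rightarrow> ((m + n + 1) div 2, - 1 - n) of (k, l) \<Rightarrow> (l + 2 * k, - 1 - l)) = p"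
      "(case case p of (m, n) \<Rightarrow> ((m + n + 1) div 2, - 1 - n) of (k, l) \<Rightarrow> ?g (l + 2 * k, - 1 - l)) = ?g p"
      by (simp_all only: p prod.case)
  qed auto
  with a have 2: "(?g has_sum a) {(m, n). odd (m + n)}" unfolding eqs(2) by blast
  have "(?g has_sum (a + a)) (UNIV \<times> UNIV)"
    unfolding UNIV_parity_sum by (rule has_sum_Un_disjoint[OF 1 2]) auto
  hence "th2 s * th2 (3 * s) / 2 = a"
    using g has_sum_unique by fastforce
  thus ?thesis
    using \<open>(?f has_sum a) ?O\<close> by (simp only:)
qed

text \<open>The signs of the two \<open>th4\<close> series multiply to \<open>(-1)^(m + n)\<close>,
  so the difference of the products cancels the terms with \<open>m + n\<close> even and doubles the
  others.\<close>

lemma th_cubic_modular: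
  assumes "s > 0"
  shows "th3 s * th3 (3 * s) = th4 s * th4 (3 * s) + th2 s * th2 (3 * s)"
proof -
  let ?f = "\<lambda>(m::int, n::int). exp (- (s * (of_int m)\<^sup>2)) * exp (- (3 * s * (of_int n)\<^sup>2))"
  let ?h = "\<lambda>(m::int, n::int). (if even m then 1 else -1) * exp (- (s * (of_int m)\<^sup>2)) *
    ((if even n then 1 else -1) * exp (- (3 * s * (of_int n)\<^sup>2)))"
  have f: "(?f has_sum (th3 s * th3 (3 * s))) (UNIV \<times> UNIV)"
    and h: "(?h has_sum (th4 s * th4 (3 * s))) (UNIV \<times> UNIV)"
    using assms by (intro has_sum_Times_mult has_sum_th3 has_sum_th4; simp)+
  have "((\<lambda>p. ?f p - ?h p) has_sum (th2 s * th2 (3 * s))) {(m, n). odd (m + n)}"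
    using has_sum_cmult_right[OF th_cubic_modular_aux[OF assms], of 2]
    by (simp add: case_prod_unfold) (rule has_sum_cong[THEN iffD1, rotated], assumption, auto)
  hence "((\<lambda>p. ?f p - ?h p) has_sum (th2 s * th2 (3 * s))) (UNIV \<times> UNIV)"
    by (rule has_sum_cong_neutral[THEN iffD1, rotated -1]) (auto split: if_splits)
  moreover have "((\<lambda>p. ?f p + - ?h p) has_sum (th3 s * th3 (3 * s) + - (th4 s * th4 (3 * s)))) (UNIV \<times> UNIV)"
    using has_sum_add[OF f has_sum_uminusI[OF h]] .
  ultimately show ?thesis
    using has_sum_unique by fastforce
qed

section \<open>The arithmetic-geometric mean\<close>

lemma absolutely_integrable_substitution:
  fixes f g g' h :: "real \<Rightarrow> real"
  assumes "S \<in> sets lebesgue" "\<And>x. x \<in> S \<Longrightarrow> (g has_field_derivative g' x) (at x within S)" "inj_on g S"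
    and eq: "\<And>x. x \<in> S \<Longrightarrow> \<bar>g' x\<bar> * f (g x) = h x"
    and h: "h absolutely_integrable_on S"
  shows "f absolutely_integrable_on g ` S" "integral (g ` S) f = integral S h"
proof -
  have "(\<lambda>x. \<bar>g' x\<bar> * f (g x)) absolutely_integrable_on S"
    using h by (rule set_integrable_cong[THEN iffD1, rotated -1]) (auto simp: eq)
  moreover have "integral S (\<lambda>x. \<bar>g' x\<bar> * f (g x)) = integral S h"
    by (intro integral_cong eq)
  ultimately show "f absolutely_integrable_on g ` S" "integral (g ` S) f = integral S h"
    using has_absolute_integral_change_of_variables_1'[OF assms(1-3), of f "integral S h"] by blast+
qed

lemma integral_UNIV_even:
  fixes f :: "real \<Rightarrow> real"
  assumes f: "f absolutely_integrable_on UNIV" and even: "\<And>x. f (- x) = f x"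
  shows "integral UNIV f = 2 * integral {0<..} f"
proof -
  have pos: "f absolutely_integrable_on {0<..}" and neg: "f absolutely_integrable_on {..<0}"
    using f by (auto intro: set_integrable_subset)
  have img: "uminus ` {0<..} = {..<0::real}"
    by (auto intro: image_eqI[of _ _ "- x" for x])
  have "(\<lambda>x. \<bar>-1\<bar> * f (- x)) absolutely_integrable_on {0<..} \<and>
      integral {0<..} (\<lambda>x. \<bar>-1\<bar> * f (- x)) = integral {..<0} f"
    unfolding img[symmetric] using neg
    by (subst has_absolute_integral_change_of_variables_1')
      (auto intro!: derivative_eq_intros inj_onI simp: img)
  hence "integral {..<0} f = integral {0<..} f"
    by (simp add: even)
  moreover have "integral ({..<0} \<union> {0<..}) f = integral {..<0} f + integral {0<..} f"
  proof (rule Henstock_Kurzweil_Integration.integral_Un)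
    have "{..<0} \<inter> {0<..} = ({} :: real set)" by auto
    thus "negligible ({..<0} \<inter> {0<..} :: real set)" by simp
  qed (use pos neg set_lebesgue_integral_eq_integral(1) in blast)+
  moreover have "integral ({..<0} \<union> {0<..}) f = integral UNIV f"
    by (rule integral_spike_set; rule negligible_subset[of "{0}"]) auto
  ultimately show ?thesis by simp
qed

lemma cauchy_integral:
  fixes a :: real
  assumes "a > 0"
  shows "(\<lambda>t. 1 / (t\<^sup>2 + a\<^sup>2)) absolutely_integrable_on UNIV"
    and "integral UNIV (\<lambda>t. 1 / (t\<^sup>2 + a\<^sup>2)) = pi / a"
proof -
  let ?S = "{- (pi / 2)<..<pi / 2}" and ?g = "\<lambda>x. a * tan x"
  have img: "?g ` ?S = UNIV"
  proof -
    have "y \<in> ?g ` ?S" for y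
      using arctan[of "y / a"] assms by (intro image_eqI[of _ _ "arctan (y / a)"]) auto
    thus ?thesis by blast
  qed
  have cos: "cos x > 0" if "x \<in> ?S" for x using that by (auto intro: cos_gt_zero_pi)
  have inj: "inj_on ?g ?S"
    using assms arctan_tan by (auto intro!: inj_on_inverseI[of _ "\<lambda>y. arctan (y / a)"])
  have eq: "\<bar>a * inverse ((cos x)\<^sup>2)\<bar> * (1 / ((?g x)\<^sup>2 + a\<^sup>2)) = 1 / a" if "x \<in> ?S" for x
  proof -
    have "(?g x)\<^sup>2 + a\<^sup>2 = a\<^sup>2 * (inverse (cos x))\<^sup>2"
      using tan_sec[of x] cos[OF that] by (simp add: power_mult_distrib distrib_left flip: tan_sec)
    thus ?thesis using cos[OF that] assms by (simp add: field_simps power2_eq_square)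
  qed
  have "(\<lambda>x. 1 / a) absolutely_integrable_on ?S"
    using absolutely_integrable_on_const[of ?S "1 / a"] by simp
  moreover have "integral ?S (\<lambda>x. 1 / a) = pi / a"
    by (simp add: integral_open_interval_real[symmetric] flip: mult_2)
  moreover have "(?g has_field_derivative a * inverse ((cos x)\<^sup>2)) (at x within ?S)" if "x \<in> ?S" for x
    using cos[OF that] by (auto intro!: derivative_eq_intros)
  ultimately show "(\<lambda>t. 1 / (t\<^sup>2 + a\<^sup>2)) absolutely_integrable_on UNIV"
    "integral UNIV (\<lambda>t. 1 / (t\<^sup>2 + a\<^sup>2)) = pi / a"
    using absolutely_integrable_substitution[of ?S ?g "\<lambda>x. a * inverse ((cos x)\<^sup>2)"
        "\<lambda>t. 1 / (t\<^sup>2 + a\<^sup>2)" "\<lambda>x. 1 / a", OF _ _ inj eq] by (simp_all flip: img)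
qed

section \<open>The complete elliptic integral and its Landen substitution\<close>

definition ell_fun :: "real \<Rightarrow> real \<Rightarrow> real \<Rightarrow> real" where
  "ell_fun a b t = 1 / sqrt ((t\<^sup>2 + a\<^sup>2) * (t\<^sup>2 + b\<^sup>2))"

text \<open>For \<open>k^2 + k'^2 = 1\<close> with positive \<open>k\<close> and \<open>k'\<close>,
  the value \<open>ell 1 k'\<close> is \<open>2 K(k)\<close>, twice the complete elliptic integral
  of the first kind.\<close>

definition ell :: "real \<Rightarrow> real \<Rightarrow> real" where
  "ell a b = integral UNIV (ell_fun a b)"

lemma ell_fun_even: "ell_fun a b (- t) = ell_fun a b t"
  by (simp add: ell_fun_def)

lemma ell_fun_pos: "a > 0 \<Longrightarrow> b > 0 \<Longrightarrow> ell_fun a b t > 0"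
  unfolding ell_fun_def by (auto intro!: divide_pos_pos mult_pos_pos add_nonneg_pos)

lemma ell_fun_antimono:
  assumes "0 < a" "0 < b" "a \<le> c" "b \<le> d"
  shows "ell_fun c d t \<le> ell_fun a b t"
proof -
  have "(t\<^sup>2 + a\<^sup>2) * (t\<^sup>2 + b\<^sup>2) \<le> (t\<^sup>2 + c\<^sup>2) * (t\<^sup>2 + d\<^sup>2)"
    using assms by (intro mult_mono add_left_mono power_mono) auto
  moreover have "(t\<^sup>2 + a\<^sup>2) * (t\<^sup>2 + b\<^sup>2) > 0"
    using assms by (intro mult_pos_pos add_nonneg_pos) auto
  ultimately show ?thesis
    unfolding ell_fun_def by (auto intro!: divide_left_mono mult_pos_pos)
qed

lemma ell_fun_diag: "ell_fun c c t = 1 / (t\<^sup>2 + c\<^sup>2)"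
  by (simp add: ell_fun_def abs_of_nonneg flip: power2_eq_square)

lemma continuous_on_ell_fun: "a > 0 \<Longrightarrow> b > 0 \<Longrightarrow> continuous_on S (ell_fun a b)"
  unfolding ell_fun_def
  by (intro continuous_intros) (auto simp: sum_power2_eq_zero_iff)

lemma ell_fun_integrable:
  assumes "a > 0" "b > 0"
  shows "ell_fun a b absolutely_integrable_on UNIV"
proof (rule measurable_bounded_by_integrable_imp_absolutely_integrable)
  show "ell_fun a b \<in> borel_measurable (lebesgue_on UNIV)"
    using assms by (intro continuous_imp_measurable_on_sets_lebesgue continuous_on_ell_fun) auto
  show "(\<lambda>t. 1 / (t\<^sup>2 + (min a b)\<^sup>2)) integrable_on UNIV"
    using cauchy_integral(1)[of "min a b"] assms by (simp add: absolutely_integrable_on_def)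
  show "norm (ell_fun a b t) \<le> 1 / (t\<^sup>2 + (min a b)\<^sup>2)" for t
    using ell_fun_antimono[of "min a b" "min a b" a b t] ell_fun_pos[of a b t] assms
    by (simp add: ell_fun_diag)
qed auto

lemma ell_fun_integrable': "a > 0 \<Longrightarrow> b > 0 \<Longrightarrow> ell_fun a b integrable_on UNIV"
  using ell_fun_integrable absolutely_integrable_on_def by blast

lemma ell_diag: "c > 0 \<Longrightarrow> ell c c = pi / c"
  unfolding ell_def ell_fun_diag[THEN ext] by (rule cauchy_integral(2))

lemma ell_antimono:
  assumes "0 < a" "0 < b" "a \<le> c" "b \<le> d"
  shows "ell c d \<le> ell a b"
  unfolding ell_def using assms ell_fun_antimono
  by (intro integral_le ell_fun_integrable') auto

lemma ell_strict_antimono: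
  assumes "0 < a" "0 < b" "b < d"
  shows "ell a d < ell a b"
proof -
  have less: "ell_fun a d t < ell_fun a b t" for t
  proof -
    have "b\<^sup>2 < d\<^sup>2" using assms by (intro power_strict_mono) auto
    hence "(t\<^sup>2 + a\<^sup>2) * (t\<^sup>2 + b\<^sup>2) < (t\<^sup>2 + a\<^sup>2) * (t\<^sup>2 + d\<^sup>2)"
      using assms by (intro mult_strict_left_mono add_nonneg_pos) auto
    moreover have "(t\<^sup>2 + a\<^sup>2) * (t\<^sup>2 + b\<^sup>2) > 0"
      using assms by (intro mult_pos_pos add_nonneg_pos) auto
    ultimately show ?thesis
      unfolding ell_fun_def by (auto intro!: divide_strict_left_mono mult_pos_pos)
  qed
  let ?d = "\<lambda>t. ell_fun a b t - ell_fun a d t"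
  have int: "?d integrable_on UNIV"
    using assms by (intro integrable_diff ell_fun_integrable') auto
  have cont: "continuous_on {0..1} (ell_fun a b)" "continuous_on {0..1} (ell_fun a d)"
    using assms by (auto intro: continuous_on_ell_fun)
  \<comment> \<open>Strictness is gained on a compact interval, where continuity applies; elsewhere
    a nonnegative difference is enough.\<close>
  hence "integral {0..1} (ell_fun a d) < integral {0..1} (ell_fun a b)"
    using less by (intro integral_less_real) auto
  also have "integral {0..1} (ell_fun a b) = integral {0..1} (ell_fun a d) + integral {0..1} ?d"
    using cont by (simp add: integral_diff integrable_continuous_interval)
  finally have "0 < integral {0..1} ?d" by simp
  also have "\<dots> \<le> integral UNIV ?d"
    using int less by (intro integral_subset_le) (auto intro: less_imp_le integrable_on_subinterval)
  also have "\<dots> = ell a b - ell a d"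
    unfolding ell_def using assms by (intro integral_diff ell_fun_integrable') auto
  finally show ?thesis by simp
qed

lemma ell_scale:
  assumes "a > 0" "b > 0" "c > 0"
  shows "ell (c * a) (c * b) = ell a b / c"
proof -
  have img: "(\<lambda>t. c * t) ` UNIV = UNIV"
    using assms by (metis surj_def nonzero_mult_div_cancel_left less_numeral_extra(3) times_divide_eq_right)
  have "(\<lambda>t. \<bar>c\<bar> * ell_fun (c * a) (c * b) (c * t)) absolutely_integrable_on UNIV \<and>
      integral UNIV (\<lambda>t. \<bar>c\<bar> * ell_fun (c * a) (c * b) (c * t)) = ell (c * a) (c * b)"
    using assms ell_fun_integrable[of "c * a" "c * b"]
    by (subst has_absolute_integral_change_of_variables_1'[where g = "\<lambda>t. c * t"])
      (auto intro!: derivative_eq_intros inj_onI simp: img ell_def)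
  moreover have "\<bar>c\<bar> * ell_fun (c * a) (c * b) (c * t) = ell_fun a b t / c" for t
  proof -
    have "((c * t)\<^sup>2 + (c * a)\<^sup>2) * ((c * t)\<^sup>2 + (c * b)\<^sup>2) = (c\<^sup>2)\<^sup>2 * ((t\<^sup>2 + a\<^sup>2) * (t\<^sup>2 + b\<^sup>2))"
      by algebra
    hence "sqrt (((c * t)\<^sup>2 + (c * a)\<^sup>2) * ((c * t)\<^sup>2 + (c * b)\<^sup>2)) = c\<^sup>2 * sqrt ((t\<^sup>2 + a\<^sup>2) * (t\<^sup>2 + b\<^sup>2))"
      by (simp only: real_sqrt_mult real_sqrt_abs abs_power2)
    thus ?thesis using assms by (simp add: ell_fun_def power2_eq_square)
  qed
  ultimately show ?thesis by (simp add: ell_def)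
qed

text \<open>The substitution \<open>u = (t - p / t) / 2\<close> maps the positive half-line
  bijectively onto the line. The choice \<open>p = a b\<close> gives AGM invariance, and
  \<open>p = a^2\<close> the quartic form of the integral.\<close>

lemma landen_integral:
  fixes f :: "real \<Rightarrow> real"
  assumes "p > 0" "f absolutely_integrable_on UNIV"
    and eq: "\<And>t. t > 0 \<Longrightarrow> (1 + p / t\<^sup>2) / 2 * f ((t - p / t) / 2) = h t"
  shows "integral UNIV f = integral {0<..} h"
proof -
  let ?g = "\<lambda>t. (t - p / t) / 2"
  have img: "?g ` {0<..} = UNIV"
  proof -
    have "u \<in> ?g ` {0<..}" for u
    proof -
      \<comment> \<open>The positive root of \<open>t^2 - 2 u t - p = 0\<close>.\<close>
      define t where "t = u + sqrt (u\<^sup>2 + p)"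
      have "sqrt (u\<^sup>2 + p) > sqrt (u\<^sup>2)" using assms by (intro real_sqrt_less_mono) simp
      hence "t > 0" unfolding t_def by simp
      moreover have "t\<^sup>2 = 2 * u * t + p"
        using assms by (simp add: t_def power2_eq_square algebra_simps flip: real_sqrt_mult)
      hence "u = ?g t" using \<open>t > 0\<close> by (simp add: field_simps power2_eq_square)
      ultimately show ?thesis by blast
    qed
    thus ?thesis by blast
  qed
  have inj: "inj_on ?g {0<..}"
  proof (rule linorder_inj_onI')
    fix s t :: real assume st: "s \<in> {0<..}" "t \<in> {0<..}" "s < t"
    hence "p / t < p / s" using assms by (intro divide_strict_left_mono) auto
    thus "?g s \<noteq> ?g t" using st by auto
  qed
  have "(\<lambda>t. \<bar>(1 + p / t\<^sup>2) / 2\<bar> * f (?g t)) absolutely_integrable_on {0<..} \<and>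
      integral {0<..} (\<lambda>t. \<bar>(1 + p / t\<^sup>2) / 2\<bar> * f (?g t)) = integral UNIV f"
    using assms
    by (subst has_absolute_integral_change_of_variables_1'[OF _ _ inj])
      (auto intro!: derivative_eq_intros simp: img power2_eq_square)
  moreover have "integral {0<..} (\<lambda>t. \<bar>(1 + p / t\<^sup>2) / 2\<bar> * f (?g t)) = integral {0<..} h"
    using assms by (intro integral_cong) (simp flip: eq)
  ultimately show ?thesis by simp
qed

text \<open>The factor \<open>x = t^2 + p\<close> occurs in the Jacobian and in the transformed
  square root, and cancels.\<close>

lemma landen_cancel:
  fixes t x S :: real
  assumes "t > 0" "x > 0"
  shows "x / t\<^sup>2 / 2 * (1 / (x / (4 * t\<^sup>2) * S)) = 2 * (1 / S)"
  using assms by (simp add: divide_simps)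

lemma ell_agm:
  assumes "a > 0" "b > 0"
  shows "ell ((a + b) / 2) (sqrt (a * b)) = ell a b"
proof -
  have "(1 + a * b / t\<^sup>2) / 2 * ell_fun ((a + b) / 2) (sqrt (a * b)) ((t - a * b / t) / 2) = 2 * (ell_fun a b t)"
    if "t > 0" for t
  proof -
    let ?u = "(t - a * b / t) / 2"
    \<comment> \<open>The geometric-mean factor becomes a perfect square,
      \<open>?u^2 + a b = ((t^2 + a b) / (2 t))^2\<close>, while the arithmetic-mean factor becomes
      \<open>(t^2 + a^2) (t^2 + b^2) / (4 t^2)\<close>.\<close>
    have "(?u\<^sup>2 + ((a + b) / 2)\<^sup>2) * (?u\<^sup>2 + (sqrt (a * b))\<^sup>2) =
        ((t\<^sup>2 + a * b) / (4 * t\<^sup>2))\<^sup>2 * ((t\<^sup>2 + a\<^sup>2) * (t\<^sup>2 + b\<^sup>2))"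
      using that assms by (simp add: field_simps) algebra
    hence "sqrt ((?u\<^sup>2 + ((a + b) / 2)\<^sup>2) * (?u\<^sup>2 + (sqrt (a * b))\<^sup>2)) =
        (t\<^sup>2 + a * b) / (4 * t\<^sup>2) * sqrt ((t\<^sup>2 + a\<^sup>2) * (t\<^sup>2 + b\<^sup>2))"
      using assms by (simp add: real_sqrt_mult)
    moreover have "1 + a * b / t\<^sup>2 = (t\<^sup>2 + a * b) / t\<^sup>2" "t\<^sup>2 + a * b > 0"
      using that assms by (auto simp: field_simps intro!: add_pos_pos)
    ultimately show ?thesis
      using that by (simp only: ell_fun_def landen_cancel)
  qed
  hence "ell ((a + b) / 2) (sqrt (a * b)) = integral {0<..} (\<lambda>t. 2 * ell_fun a b t)"
    unfolding ell_def using assms by (intro landen_integral[of "a * b"] ell_fun_integrable) auto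
  thus ?thesis
    using integral_UNIV_even[OF ell_fun_integrable ell_fun_even] assms by (simp add: ell_def)
qed

text \<open>Landen's substitution with \<open>b\<close> as arithmetic and \<open>a\<close> as geometric mean: for \<open>a > b\<close> these are the
  means of two complex conjugates, so the quartic no longer splits over the reals into factors linear in \<open>t\<^sup>2\<close>.\<close>

lemma ell_quartic:
  assumes "a > 0" "b > 0"
  shows "ell a b = integral {0<..} (\<lambda>t. 2 / sqrt (t ^ 4 + (4 * b\<^sup>2 - 2 * a\<^sup>2) * t\<^sup>2 + a ^ 4))"
proof -
  have "(1 + a\<^sup>2 / t\<^sup>2) / 2 * ell_fun a b ((t - a\<^sup>2 / t) / 2) =
      2 / sqrt (t ^ 4 + (4 * b\<^sup>2 - 2 * a\<^sup>2) * t\<^sup>2 + a ^ 4)" (is "_ = 2 / sqrt ?Q")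
    if "t > 0" for t
  proof -
    let ?u = "(t - a\<^sup>2 / t) / 2"
    have "(?u\<^sup>2 + a\<^sup>2) * (?u\<^sup>2 + b\<^sup>2) = ((t\<^sup>2 + a\<^sup>2) / (4 * t\<^sup>2))\<^sup>2 * ?Q"
      using that assms by (simp add: field_simps) algebra
    hence "sqrt ((?u\<^sup>2 + a\<^sup>2) * (?u\<^sup>2 + b\<^sup>2)) = (t\<^sup>2 + a\<^sup>2) / (4 * t\<^sup>2) * sqrt ?Q"
      using assms by (simp add: real_sqrt_mult)
    moreover have "1 + a\<^sup>2 / t\<^sup>2 = (t\<^sup>2 + a\<^sup>2) / t\<^sup>2" "t\<^sup>2 + a\<^sup>2 > 0"
      using that assms by (auto simp: field_simps intro!: add_pos_pos)
    ultimately have "(1 + a\<^sup>2 / t\<^sup>2) / 2 * ell_fun a b ?u = 2 * (1 / sqrt ?Q)"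
      using that by (simp only: ell_fun_def landen_cancel)
    thus ?thesis by simp
  qed
  thus ?thesis
    unfolding ell_def using assms by (intro landen_integral[of "a\<^sup>2"] ell_fun_integrable) auto
qed

text \<open>Near the origin the integrand behaves like \<open>1 / sqrt (t^2 + e^2)\<close>, whose
  integral over \<open>[-1, 1]\<close> is \<open>2 arsinh (1 / e) = - 2 ln e + O(1)\<close>. Any
  uniform bound serves, since the error is later divided by \<open>2^n\<close>.\<close>

lemma ell_log_asymptotics:
  assumes "0 < e" "e \<le> 1"
  shows "\<bar>ell 1 e + 2 * ln e\<bar> \<le> 12"
proof -
  let ?h = "\<lambda>t. 1 / sqrt (t\<^sup>2 + e\<^sup>2)"
  have pos: "sqrt (t\<^sup>2 + e\<^sup>2) > 0" for t using assms by (simp add: add_nonneg_pos)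
  have h: "(?h has_integral (2 * arsinh (1 / e))) {-1..1}"
  proof -
    have "(?h has_integral (arsinh (1 / e) - arsinh (-1 / e))) {-1..1}"
    proof (rule fundamental_theorem_of_calculus)
      fix t :: real
      have "sqrt ((t / e)\<^sup>2 + 1) = sqrt (t\<^sup>2 + e\<^sup>2) / e"
      proof -
        have "(t / e)\<^sup>2 + 1 = (t\<^sup>2 + e\<^sup>2) / e\<^sup>2" using assms by (simp add: field_simps)
        thus ?thesis using assms by (simp add: real_sqrt_divide)
      qed
      hence "1 / sqrt ((t / e)\<^sup>2 + 1) * (1 / e) = ?h t"
        using assms by simp
      moreover have "((\<lambda>t. arsinh (t / e)) has_real_derivative (1 / sqrt ((t / e)\<^sup>2 + 1) * (1 / e)))
          (at t within {-1..1})"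
        using assms by (intro DERIV_chain2[OF arsinh_real_has_field_derivative]) (auto intro!: derivative_eq_intros)
      ultimately show "((\<lambda>t. arsinh (t / e)) has_vector_derivative ?h t) (at t within {-1..1})"
        by (simp only: has_real_derivative_iff_has_vector_derivative)
    qed auto
    thus ?thesis using arsinh_minus_real[of "1 / e"] by simp
  qed
  have arsinh: "arsinh (1 / e) = ln (1 + sqrt (1 + e\<^sup>2)) - ln e"
  proof -
    have "(1 / e)\<^sup>2 + 1 = (1 + e\<^sup>2) / e\<^sup>2" using assms by (simp add: field_simps)
    hence "sqrt ((1 / e)\<^sup>2 + 1) = sqrt (1 + e\<^sup>2) / e"
      using assms by (simp only: real_sqrt_divide) simp
    hence "1 / e + sqrt ((1 / e)\<^sup>2 + 1) = (1 + sqrt (1 + e\<^sup>2)) / e"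
      by (simp only: add_divide_distrib)
    moreover have "1 + sqrt (1 + e\<^sup>2) > 0" by (simp add: add_pos_nonneg)
    ultimately show ?thesis using assms by (simp add: arsinh_real_def ln_div)
  qed
  have lns: "0 \<le> ln (1 + sqrt (1 + e\<^sup>2))" "ln (1 + sqrt (1 + e\<^sup>2)) \<le> 2"
  proof -
    have "sqrt (1 + e\<^sup>2) \<le> 2"
      using assms power_le_one[of e 2] by (intro real_le_lsqrt) auto
    moreover have "0 \<le> sqrt (1 + e\<^sup>2)" "0 < 1 + sqrt (1 + e\<^sup>2)" by (simp_all add: add_pos_nonneg)
    ultimately show "0 \<le> ln (1 + sqrt (1 + e\<^sup>2))" "ln (1 + sqrt (1 + e\<^sup>2)) \<le> 2"
      using ln_le_minus_one[of "1 + sqrt (1 + e\<^sup>2)"] by auto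
  qed
  have f: "(ell_fun 1 e has_integral ell 1 e) UNIV"
    unfolding ell_def using assms by (intro integrable_integral ell_fun_integrable') auto
  have c: "((\<lambda>t. 2 * (1 / (t\<^sup>2 + 1\<^sup>2))) has_integral 2 * pi) UNIV"
    using cauchy_integral[of 1] unfolding absolutely_integrable_on_def
    by (intro has_integral_mult_right) (auto simp: has_integral_iff)
  \<comment> \<open>Inside \<open>[-1, 1]\<close> the factor \<open>sqrt (t^2 + 1) \<ge> 1\<close>
    is dropped; outside, the integrand is at most
    \<open>1 / t^2 \<le> 2 / (t^2 + 1)\<close>.\<close>
  have upper: "ell 1 e \<le> 2 * arsinh (1 / e) + 2 * pi"
  proof (rule has_integral_le[OF f])
    show "((\<lambda>t. (if t \<in> {-1..1} then ?h t else 0) + 2 * (1 / (t\<^sup>2 + 1\<^sup>2))) has_integral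
        2 * arsinh (1 / e) + 2 * pi) UNIV"
      using h c by (intro has_integral_add) (simp_all add: has_integral_restrict_UNIV del: atLeastAtMost_iff)
    fix t :: real
    show "ell_fun 1 e t \<le> (if t \<in> {-1..1} then ?h t else 0) + 2 * (1 / (t\<^sup>2 + 1\<^sup>2))"
    proof (cases "t \<in> {-1..1}")
      case True
      have "ell_fun 1 e t = ?h t / sqrt (t\<^sup>2 + 1)"
        by (simp add: ell_fun_def real_sqrt_mult)
      also have "\<dots> \<le> ?h t"
        using divide_left_mono[of 1 "sqrt (t\<^sup>2 + 1)" "?h t"] pos[of t] by (simp add: add_nonneg_pos)
      finally show ?thesis using True by (simp add: add_increasing2)
    next
      case False
      hence "t\<^sup>2 \<ge> 1" using abs_le_square_iff[of 1 t] by auto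
      have "(t\<^sup>2)\<^sup>2 \<le> (t\<^sup>2 + 1\<^sup>2) * (t\<^sup>2 + e\<^sup>2)"
        unfolding power2_eq_square[of "t\<^sup>2"] by (intro mult_mono) auto
      hence "t\<^sup>2 \<le> sqrt ((t\<^sup>2 + 1\<^sup>2) * (t\<^sup>2 + e\<^sup>2))"
        by (rule real_le_rsqrt)
      hence "ell_fun 1 e t \<le> 1 / t\<^sup>2"
        using \<open>t\<^sup>2 \<ge> 1\<close> unfolding ell_fun_def
        by (intro divide_left_mono) (auto intro!: mult_pos_pos add_pos_nonneg)
      also have "\<dots> \<le> 2 * (1 / (t\<^sup>2 + 1\<^sup>2))"
        using \<open>t\<^sup>2 \<ge> 1\<close> frac_le[of 2 2 "t\<^sup>2 + 1" "2 * t\<^sup>2"] by simp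
      finally show ?thesis using False by auto
    qed
  qed
  \<comment> \<open>From \<open>1 / sqrt (t^2 + 1) \<ge> 1 - \<bar>t\<bar>\<close> and
    \<open>\<bar>t\<bar> \<le> sqrt (t^2 + e^2)\<close>, the integrand falls short of
    \<open>?h t\<close> by at most 1, hence by at most 2 over the interval.\<close>
  have lower: "2 * arsinh (1 / e) - 2 \<le> ell 1 e"
  proof (rule has_integral_le[OF _ f])
    have "((\<lambda>t::real. 1::real) has_integral 2) {-1..1}"
      using has_integral_const_real[of "1::real" "-1" 1] by simp
    thus "((\<lambda>t. if t \<in> {-1..1} then ?h t - 1 else 0) has_integral 2 * arsinh (1 / e) - 2) UNIV"
      unfolding has_integral_restrict_UNIV using h by (intro has_integral_diff) auto
    fix t :: real
    show "(if t \<in> {-1..1} then ?h t - 1 else 0) \<le> ell_fun 1 e t"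
    proof (cases "t \<in> {-1..1}")
      case True
      define r where "r = sqrt (t\<^sup>2 + e\<^sup>2)"
      have r: "r > 0" "\<bar>t\<bar> \<le> r" using pos[of t] by (auto simp: r_def intro!: real_le_rsqrt)
      have "sqrt (t\<^sup>2 + 1) \<le> 1 + \<bar>t\<bar>"
        by (rule real_le_lsqrt) (auto simp: power2_eq_square algebra_simps)
      hence "(1 - \<bar>t\<bar>) * sqrt (t\<^sup>2 + 1) \<le> (1 - \<bar>t\<bar>) * (1 + \<bar>t\<bar>)"
        using True by (intro mult_left_mono) auto
      also have "\<dots> \<le> 1" by (simp add: algebra_simps)
      finally have "1 - \<bar>t\<bar> \<le> 1 / sqrt (t\<^sup>2 + 1)"
        by (simp add: le_divide_eq add_nonneg_pos)
      hence "(1 - \<bar>t\<bar>) / r \<le> ell_fun 1 e t"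
        using r divide_right_mono[of "1 - \<bar>t\<bar>" "1 / sqrt (t\<^sup>2 + 1)" r]
        by (simp add: ell_fun_def r_def real_sqrt_mult)
      moreover have "1 / r - 1 \<le> (1 - \<bar>t\<bar>) / r" using r by (simp add: field_simps)
      ultimately show ?thesis using True by (simp add: r_def)
    qed (use ell_fun_pos[of 1 e t] assms in auto)
  qed
  show ?thesis using upper lower arsinh lns pi_less_4 by linarith
qed

section \<open>The integral at the singular modulus\<close>

lemma Beta_Ioo:
  fixes a b :: real
  assumes "a > 0" "b > 0"
  shows "(\<lambda>t. t powr (a - 1) * (1 - t) powr (b - 1)) absolutely_integrable_on {0<..<1}"
    and "integral {0<..<1} (\<lambda>t. t powr (a - 1) * (1 - t) powr (b - 1)) = Beta a b"
proof -
  have "((\<lambda>t. t powr (a - 1) * (1 - t) powr (b - 1)) has_integral Beta a b) {0<..<1}"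
    using has_integral_Beta_real[OF assms] by (simp add: has_integral_Icc_iff_Ioo)
  thus "integral {0<..<1} (\<lambda>t. t powr (a - 1) * (1 - t) powr (b - 1)) = Beta a b"
    and "(\<lambda>t. t powr (a - 1) * (1 - t) powr (b - 1)) absolutely_integrable_on {0<..<1}"
    by (auto simp: has_integral_iff intro!: nonnegative_absolutely_integrable_1)
qed

text \<open>The pointwise computation behind the substitution in \<open>ell_singular\<close>:
  Jacobian times integrand on the left, a multiple of the beta integrand on the right.\<close>

lemma singular_quartic:
  fixes v :: real
  assumes v: "0 < v" "v < 1"
  defines "t \<equiv> sqrt ((v powr (-1/3) - 1) / sqrt 3)"
  shows "v powr (-4/3) / (6 * sqrt 3 * t) * (2 / sqrt (t ^ 4 + sqrt 3 * t\<^sup>2 + 1)) =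
         3 powr (-3/4) * (v powr (1/6 - 1) * (1 - v) powr (1/2 - 1))"
proof -
  define x where "x = v powr (-1/3)"
  have "x > v powr 0" unfolding x_def using v by (intro powr_less_mono') auto
  hence x: "x > 1" using v by simp
  have x3: "x ^ 3 = 1 / v"
  proof -
    have "x ^ 3 = x powr 3" using x by simp
    also have "\<dots> = v powr (-1/3 * 3)" unfolding x_def powr_powr ..
    also have "\<dots> = 1 / v" using v by (simp add: powr_minus_divide)
    finally show ?thesis .
  qed
  have t2: "t\<^sup>2 = (x - 1) / sqrt 3" and t: "t > 0"
    unfolding t_def x_def[symmetric] using x by simp_all
  have t4: "t ^ 4 = (x - 1)\<^sup>2 / 3"
  proof -
    have "t ^ 4 = (t\<^sup>2)\<^sup>2" by simp
    thus ?thesis by (simp add: t2 power_divide del: power2_eq_iff_nonneg)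
  qed
  have Q: "t ^ 4 + sqrt 3 * t\<^sup>2 + 1 = (x\<^sup>2 + x + 1) / 3"
    unfolding t4 t2 by (simp add: field_simps power2_eq_square)
  \<comment> \<open>The factors recombine to \<open>x^3 - 1 = (1 - v) / v\<close>.\<close>
  have "(t * sqrt ((x\<^sup>2 + x + 1) / 3))\<^sup>2 = (x - 1) * (x\<^sup>2 + x + 1) / (3 * sqrt 3)"
    using x by (simp add: power_mult_distrib t2 add_nonneg_nonneg)
  also have "\<dots> = (1 - v) / (v * (3 * sqrt 3))"
    using x3 v by (simp add: algebra_simps power2_eq_square power3_eq_cube) (simp add: field_simps)
  finally have "t * sqrt ((x\<^sup>2 + x + 1) / 3) = sqrt ((1 - v) / (v * (3 * sqrt 3)))"
    using t x by (intro real_sqrt_unique[symmetric]) auto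
  also have "\<dots> = ((1 - v) powr (1/2)) / (v powr (1/2) * 3 powr (3/4))"
  proof -
    have "sqrt (3 * sqrt 3) = (3 powr 1 * 3 powr (1/2)) powr (1/2)"
      by (simp add: powr_half_sqrt)
    also have "\<dots> = 3 powr (3/4)"
      unfolding powr_add[symmetric] powr_powr by simp
    finally show ?thesis using v by (simp add: powr_half_sqrt real_sqrt_divide real_sqrt_mult)
  qed
  finally have tS: "t * sqrt ((x\<^sup>2 + x + 1) / 3) = (1 - v) powr (1/2) / (v powr (1/2) * 3 powr (3/4))" .
  have eq: "v powr (-4/3) / (6 * sqrt 3 * t) * (2 / S) = v powr (-4/3) / (3 * sqrt 3 * (t * S))" for S
    by simp
  have "v powr (-4/3) / (6 * sqrt 3 * t) * (2 / sqrt ((x\<^sup>2 + x + 1) / 3)) =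
      v powr (-4/3) * (v powr (1/2) * 3 powr (3/4)) / (3 * sqrt 3 * (1 - v) powr (1/2))"
    unfolding eq tS by simp
  also have "\<dots> = (v powr (-4/3) * v powr (1/2)) * (3 powr (3/4) / (3 powr 1 * 3 powr (1/2))) * (1 / (1 - v) powr (1/2))"
    by (simp add: powr_half_sqrt)
  also have "\<dots> = v powr (-4/3 + 1/2) * 3 powr (3/4 - (1 + 1/2)) * (1 - v) powr (- (1/2))"
    by (simp only: powr_add powr_diff powr_minus_divide)
  finally show ?thesis by (simp add: Q mult_ac)
qed

text \<open>The substitution is \<open>t\<^sup>2 = (x - 1) / sqrt 3\<close>, which depresses the cubic \<open>t\<^sup>2 (t\<^sup>4 + sqrt 3 t\<^sup>2 + 1)\<close> to
  \<open>(x\<^sup>3 - 1) / (3 sqrt 3)\<close>, followed by \<open>v = 1 / x\<^sup>3\<close>.\<close>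

lemma ell_singular:
  assumes "b > 0" "b\<^sup>2 = (2 + sqrt 3) / 4"
  shows "ell 1 b = 3 powr (-3/4) * Beta (1/6) (1/2)"
proof -
  let ?g = "\<lambda>v::real. sqrt ((v powr (-1/3) - 1) / sqrt 3)"
  let ?f = "\<lambda>t::real. 2 / sqrt (t ^ 4 + sqrt 3 * t\<^sup>2 + 1)"
  let ?h = "\<lambda>v::real. 3 powr (-3/4) * (v powr (1/6 - 1) * (1 - v) powr (1/2 - 1))"
  let ?g' = "\<lambda>v. - (v powr (-4/3)) / (6 * sqrt 3 * ?g v)"
  have gt1: "v powr (-1/3) > 1" if "v \<in> {0<..<1}" for v :: real
    using powr_less_mono'[of v "-1/3" 0] that by simp
  have img: "?g ` {0<..<1} = {0<..}"
  proof (intro equalityI subsetI)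
    fix t :: real assume "t \<in> {0<..}"
    define x where "x = 1 + sqrt 3 * t\<^sup>2"
    have x: "x > 1" using \<open>t \<in> {0<..}\<close> by (simp add: x_def)
    have "x powr (-3) < x powr 0" using x by (intro powr_less_mono) auto
    hence "x powr (-3) \<in> {0<..<1}" using x by auto
    moreover have "t = ?g (x powr (-3))"
      using x \<open>t \<in> {0<..}\<close> by (simp add: powr_powr x_def)
    ultimately show "t \<in> ?g ` {0<..<1}"
      by (intro rev_image_eqI[of "x powr (-3)" "{0<..<1}" t ?g]) simp_all
  qed (use gt1 in auto)
  have inj: "inj_on ?g {0<..<1}"
  proof (rule inj_on_inverseI)
    fix v :: real assume v: "v \<in> {0<..<1}"
    hence "(?g v)\<^sup>2 = (v powr (-1/3) - 1) / sqrt 3" using gt1[OF v] by simp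
    thus "(1 + sqrt 3 * (?g v)\<^sup>2) powr (-3) = v" using v by (simp add: powr_powr)
  qed
  have eq: "\<bar>?g' v\<bar> * ?f (?g v) = ?h v" if "v \<in> {0<..<1}" for v
  proof -
    have "\<bar>?g' v\<bar> = v powr (-4/3) / (6 * sqrt 3 * ?g v)"
      using gt1[OF that] by simp
    thus ?thesis using singular_quartic[of v] that by simp
  qed
  have "?h absolutely_integrable_on {0<..<1}"
    by (intro set_integrable_mult_right Beta_Ioo) auto
  moreover have "integral {0<..<1} ?h = 3 powr (-3/4) * Beta (1/6) (1/2)"
    using Beta_Ioo(2)[of "1/6" "1/2"] by (simp only: integral_mult_right)
  moreover have "(?g has_field_derivative ?g' v) (at v within {0<..<1})" if "v \<in> {0<..<1}" for v
  proof -
    have "((\<lambda>v. (v powr (-1/3) - 1) / sqrt 3) has_field_derivative (-1/3 * v powr (-1/3 - 1)) / sqrt 3) (at v within {0<..<1})"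
      using that by (intro DERIV_cdivide) (auto intro!: derivative_eq_intros)
    hence "(?g has_field_derivative (inverse (?g v) / 2 * ((-1/3 * v powr (-1/3 - 1)) / sqrt 3))) (at v within {0<..<1})"
      using gt1[OF that] by (intro DERIV_chain2[OF DERIV_real_sqrt]) auto
    moreover have "inverse r / 2 * ((-1/3 * P) / u) = - P / (6 * u * r)" for r P u :: real
      by (simp add: divide_simps)
    ultimately show ?thesis by simp
  qed
  ultimately have "integral (?g ` {0<..<1}) ?f = 3 powr (-3/4) * Beta (1/6) (1/2)"
    using absolutely_integrable_substitution(2)[of "{0<..<1}" ?g ?g' ?f ?h, OF _ _ inj eq] by simp
  moreover have "ell 1 b = integral {0<..} (\<lambda>t. 2 / sqrt (t ^ 4 + (4 * b\<^sup>2 - 2 * 1\<^sup>2) * t\<^sup>2 + 1 ^ 4))"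
    using ell_quartic[of 1 b] assms(1) by simp
  \<comment> \<open>Here the special modulus enters: the cubic \<open>w (w^2 + p w + 1)\<close>
    loses its linear term when depressed exactly if \<open>p^2 = 3\<close>.\<close>
  moreover have "4 * b\<^sup>2 - 2 * 1\<^sup>2 = sqrt 3" unfolding assms(2) by (simp add: field_simps)
  ultimately show ?thesis by (simp only: img power_one)
qed

text \<open>Legendre duplication at \<open>1/6\<close> eliminates \<open>Gamma (1/6)\<close>, and
  reflection at \<open>1/3\<close> then eliminates \<open>pi\<close>.\<close>

lemma Beta_sixth_half: "Beta (1/6) (1/2 :: real) = 2 powr (-1/3) * sqrt 3 * Beta (1/3) (1/3)"
proof -
  have dup: "Gamma (1/6) * Gamma (2/3 :: real) = 2 powr (2/3) * sqrt pi * Gamma (1/3)"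
  proof -
    have "complex_of_real (Gamma (1/6) * Gamma (2/3)) = of_real (2 powr (2/3) * sqrt pi * Gamma (1/3))"
    proof -
      have "complex_of_real x \<notin> \<int>\<^sub>\<le>\<^sub>0" if "x > 0" for x
        using that nonpos_Ints_nonpos[of x] by (auto simp: of_real_in_nonpos_Ints_iff)
      from this[of "1/6"] this[of "2/3"] show ?thesis
        using Gamma_legendre_duplication[of "of_real (1/6)"]
        by (simp add: powr_def flip: Gamma_complex_of_real exp_of_real)
    qed
    thus ?thesis using of_real_eq_iff by blast
  qed
  have refl: "Gamma (1/3) * Gamma (2/3 :: real) = 2 * pi / sqrt 3"
  proof -
    have "complex_of_real (Gamma (1/3) * Gamma (2/3)) = of_real (pi / sin (pi / 3))"
    proof -
      have "Gamma (1/3) = complex_of_real (Gamma (1/3))" "Gamma (2/3) = complex_of_real (Gamma (2/3))"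
        "sin (of_real pi / 3) = complex_of_real (sin (pi / 3))"
        using Gamma_complex_of_real[of "1/3"] Gamma_complex_of_real[of "2/3"] sin_of_real[of "pi / 3", where 'a = complex]
        by simp_all
      thus ?thesis using Gamma_reflection_complex[of "1/3"] by simp
    qed
    hence "Gamma (1/3) * Gamma (2/3 :: real) = pi / sin (pi / 3)"
      using of_real_eq_iff by blast
    thus ?thesis by (simp add: sin_60)
  qed
  define x where "x = Gamma (1/3 :: real)"
  define y where "y = Gamma (2/3 :: real)"
  have y: "y > 0" unfolding y_def by (rule Gamma_real_pos) simp
  have "Gamma (1/6) = 2 powr (2/3) * sqrt pi * x / y"
    using dup[folded x_def y_def] y by (simp add: field_simps)
  hence "Beta (1/6) (1/2 :: real) = 2 powr (2/3) * sqrt pi * x / y * sqrt pi / y"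
    by (simp add: Beta_def Gamma_one_half_real y_def)
  also have "\<dots> = 2 powr (2/3) * pi * x / y\<^sup>2"
    by (simp add: power2_eq_square)
  also have "pi = x * y * sqrt 3 / 2"
    unfolding refl[folded x_def y_def] by simp
  also have "2 powr (2/3) * (x * y * sqrt 3 / 2) * x / y\<^sup>2 = (2 powr (2/3) / 2 powr 1) * sqrt 3 * (x * x / y)"
    using y by (simp add: power2_eq_square)
  also have "\<dots> = 2 powr (-1/3) * sqrt 3 * Beta (1/3) (1/3)"
    unfolding powr_diff[symmetric] by (simp add: Beta_def x_def y_def)
  finally show ?thesis .
qed

section \<open>Inversion of the theta constants\<close>

lemma th3_ge_1:
  assumes "s > 0"
  shows "th3 s \<ge> 1"
proof -
  have "((\<lambda>n::int. exp (- (s * (of_int n)\<^sup>2))) has_sum 1) {0}"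
    by (rule has_sum_finiteI) auto
  thus ?thesis using has_sum_th3[OF assms] by (rule has_sum_mono2) auto
qed

lemma th2_ge:
  assumes "s > 0"
  shows "th2 s \<ge> exp (- (s / 4))"
proof -
  have "((\<lambda>n::int. exp (- (s * (of_int n + 1/2)\<^sup>2))) has_sum exp (- (s / 4))) {0}"
    by (rule has_sum_finiteI) (auto simp: power2_eq_square)
  thus ?thesis using has_sum_th2[OF assms] by (rule has_sum_mono2) auto
qed

lemma th2_pos: "s > 0 \<Longrightarrow> th2 s > 0"
  using th2_ge[of s] exp_gt_zero[of "- (s / 4)"] by linarith

lemma th3_pos: "s > 0 \<Longrightarrow> th3 s > 0"
  using th3_ge_1[of s] by linarith

lemma th3_le:
  assumes "s \<ge> 1"
  shows "th3 s \<le> 1 + exp (1 - s) * (th3 1 - 1)"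
proof -
  \<comment> \<open>For \<open>n \<noteq> 0\<close> each term is at most \<open>exp (1 - s)\<close>
    times its value at \<open>s = 1\<close>; the term at 0 does not decay, and this family makes up
    for it.\<close>
  have "((\<lambda>n::int. if n = 0 then 1 - exp (1 - s) else 0) has_sum (1 - exp (1 - s))) UNIV"
    using has_sum_finite_neutralI[of "{0::int}" UNIV "\<lambda>n. if n = 0 then 1 - exp (1 - s) else 0"] by simp
  moreover have "((\<lambda>n::int. exp (1 - s) * exp (- (1 * (of_int n)\<^sup>2))) has_sum exp (1 - s) * th3 1) UNIV"
    by (intro has_sum_cmult_right has_sum_th3) auto
  ultimately have "((\<lambda>n::int. (if n = 0 then 1 - exp (1 - s) else 0) + exp (1 - s) * exp (- (1 * (of_int n)\<^sup>2)))
      has_sum (1 - exp (1 - s) + exp (1 - s) * th3 1)) UNIV"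
    by (rule has_sum_add)
  moreover have "exp (- (s * (of_int n)\<^sup>2)) \<le>
      (if n = 0 then 1 - exp (1 - s) else 0) + exp (1 - s) * exp (- (1 * (of_int n)\<^sup>2))" for n :: int
  proof (cases "n = 0")
    case False
    hence "1 \<le> \<bar>real_of_int n\<bar>" by linarith
    hence "1 \<le> (real_of_int n)\<^sup>2" using abs_le_square_iff[of 1 "real_of_int n"] by simp
    hence "(s - 1) * 1 \<le> (s - 1) * (real_of_int n)\<^sup>2" using assms by (intro mult_left_mono) auto
    thus ?thesis using False by (simp add: algebra_simps flip: exp_add)
  qed auto
  ultimately have "th3 s \<le> 1 - exp (1 - s) + exp (1 - s) * th3 1"
    using assms by (intro has_sum_mono[OF has_sum_th3]) auto
  thus ?thesis by (simp add: algebra_simps)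
qed

text \<open>Every exponent satisfies \<open>(n + 1/2)^2 \<ge> 1/4\<close>. The rate agrees with that
  of \<open>th2_ge\<close>, so \<open>ln (th2 s)\<close> is \<open>- s / 4\<close> up to a bounded
  error.\<close>

lemma th2_le:
  assumes "s \<ge> 1"
  shows "th2 s \<le> exp (- ((s - 1) / 4)) * th2 1"
proof (rule has_sum_mono[OF has_sum_th2])
  show "((\<lambda>n::int. exp (- ((s - 1) / 4)) * exp (- (1 * (of_int n + 1/2)\<^sup>2))) has_sum
      exp (- ((s - 1) / 4)) * th2 1) UNIV"
    by (intro has_sum_cmult_right has_sum_th2) auto
  fix n :: int
  have "0 \<le> n * (n + 1)" by (cases "n \<ge> 0") (auto intro: mult_nonpos_nonpos)
  hence "0 \<le> real_of_int (n * (n + 1))" by (simp only: of_int_0_le_iff)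
  hence "1 / 4 \<le> (real_of_int n + 1/2)\<^sup>2" by (simp add: power2_eq_square algebra_simps)
  hence "(s - 1) * (1 / 4) \<le> (s - 1) * (real_of_int n + 1/2)\<^sup>2"
    using assms by (intro mult_left_mono) auto
  thus "exp (- (s * (of_int n + 1/2)\<^sup>2)) \<le> exp (- ((s - 1) / 4)) * exp (- (1 * (of_int n + 1/2)\<^sup>2))"
    by (simp add: algebra_simps flip: exp_add)
qed (use assms in auto)

lemma th3_tendsto_1: "(th3 \<longlongrightarrow> 1) at_top"
proof (rule tendsto_sandwich[of "\<lambda>_. 1" _ _ "\<lambda>s. 1 + exp (1 - s) * (th3 1 - 1)"])
  show "eventually (\<lambda>s. 1 \<le> th3 s) at_top"
    using eventually_gt_at_top[of 0] by eventually_elim (rule th3_ge_1)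
  show "eventually (\<lambda>s. th3 s \<le> 1 + exp (1 - s) * (th3 1 - 1)) at_top"
    using eventually_ge_at_top[of 1] by eventually_elim (rule th3_le)
  have "((\<lambda>s::real. exp (- s)) \<longlongrightarrow> 0) at_top"
    by (rule filterlim_compose[OF exp_at_bot filterlim_uminus_at_bot_at_top])
  from tendsto_add[OF tendsto_const[of 1] tendsto_mult_left[OF this, of "exp 1 * (th3 1 - 1)"]]
  show "((\<lambda>s. 1 + exp (1 - s) * (th3 1 - 1)) \<longlongrightarrow> 1) at_top"
    by (simp add: exp_diff exp_minus field_simps)
qed auto

lemma th4_le_th3: "s > 0 \<Longrightarrow> th4 s \<le> th3 s"
  using th3_split[of s] th4_split[of s] th2_pos[of "4 * s"] by simp

text \<open>The sum of \<open>th3 s\<close> and \<open>th4 s\<close> is \<open>2 th3 (4 s)\<close>,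
  hence at least 2.\<close>

lemma th4_ge: "s > 0 \<Longrightarrow> th4 s \<ge> 2 - th3 s"
  using th3_split[of s] th4_split[of s] th3_ge_1[of "4 * s"] by simp

lemma th4_tendsto_1: "(th4 \<longlongrightarrow> 1) at_top"
proof (rule tendsto_sandwich[of "\<lambda>s. 2 - th3 s" _ _ th3])
  show "eventually (\<lambda>s. 2 - th3 s \<le> th4 s) at_top" "eventually (\<lambda>s. th4 s \<le> th3 s) at_top"
    using eventually_gt_at_top[of 0] by (eventually_elim; simp add: th4_ge th4_le_th3)+
  show "((\<lambda>s. 2 - th3 s) \<longlongrightarrow> 1) at_top"
    using tendsto_diff[OF tendsto_const[of 2] th3_tendsto_1] by simp
qed (rule th3_tendsto_1)

lemma dyadic_at_top: "s > 0 \<Longrightarrow> filterlim (\<lambda>n. 2 ^ n * s :: real) at_top sequentially"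
  by (rule filterlim_at_top_mult_tendsto_pos[OF tendsto_const])
    (auto intro!: filterlim_at_top_mono[OF filterlim_real_sequentially] always_eventually less_imp_le of_nat_less_two_power)

text \<open>The signs alternate, so positivity is taken from the limit at infinity and carried down
  by halving: \<open>th3 u * th4 u\<close> is the square of \<open>th4 (2 u)\<close>.\<close>

lemma th4_pos:
  assumes "s > 0"
  shows "th4 s > 0"
proof -
  have "eventually (\<lambda>u. th4 u > 0) at_top"
    by (rule order_tendstoD(1)[OF th4_tendsto_1]) simp
  hence "eventually (\<lambda>n. th4 (2 ^ n * s) > 0) sequentially"
    by (rule eventually_compose_filterlim[OF _ dyadic_at_top[OF assms]])
  then obtain n where "th4 (2 ^ n * s) > 0"
    by (auto dest: eventually_happens)
  thus ?thesis
  proof (induction n)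
    case (Suc n)
    have "th4 (2 * (2 ^ n * s)) > 0"
      using Suc.prems by (simp add: mult_ac)
    hence "0 < (th4 (2 * (2 ^ n * s)))\<^sup>2"
      by simp
    hence "0 < th3 (2 ^ n * s) * th4 (2 ^ n * s)"
      using th4_double[of "2 ^ n * s"] assms by simp
    thus ?case using Suc.IH th3_pos[of "2 ^ n * s"] assms by (simp add: zero_less_mult_iff)
  qed simp
qed

text \<open>The integral is constant along \<open>s, 2 s, 4 s, ...\<close>, where both arguments
  tend to 1; monotonicity squeezes it between diagonal values \<open>pi / c\<close>.\<close>

lemma ell_th3_th4:
  assumes "s > 0"
  shows "ell ((th3 s)\<^sup>2) ((th4 s)\<^sup>2) = pi"
proof -
  define G where "G s = ell ((th3 s)\<^sup>2) ((th4 s)\<^sup>2)" for s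
  have G2: "G (2 * s) = G s" if "s > 0" for s
  proof -
    have "((th3 s)\<^sup>2 + (th4 s)\<^sup>2) / 2 = (th3 (2 * s))\<^sup>2"
      using th3_square[OF that] th4_square[OF that] by simp
    moreover have "sqrt ((th3 s)\<^sup>2 * (th4 s)\<^sup>2) = (th4 (2 * s))\<^sup>2"
      using th4_double[OF that] th3_pos[OF that] th4_pos[OF that] by (simp add: real_sqrt_mult)
    ultimately show ?thesis
      using ell_agm[of "(th3 s)\<^sup>2" "(th4 s)\<^sup>2"] th3_pos[OF that] th4_pos[OF that] by (simp add: G_def)
  qed
  have Gn: "G (2 ^ n * s) = G s" for n
    using assms by (induction n) (simp_all add: G2 mult.assoc)
  have bounds: "pi / (th3 u)\<^sup>2 \<le> G u" "G u \<le> pi / (th4 u)\<^sup>2" if "u > 0" for u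
  proof -
    have "(th4 u)\<^sup>2 \<le> (th3 u)\<^sup>2" using th4_le_th3[OF that] th4_pos[OF that] by (intro power_mono) auto
    thus "pi / (th3 u)\<^sup>2 \<le> G u" "G u \<le> pi / (th4 u)\<^sup>2"
      using ell_antimono[of "(th3 u)\<^sup>2" "(th4 u)\<^sup>2" "(th3 u)\<^sup>2" "(th3 u)\<^sup>2"]
        ell_antimono[of "(th4 u)\<^sup>2" "(th4 u)\<^sup>2" "(th3 u)\<^sup>2" "(th4 u)\<^sup>2"]
        ell_diag[of "(th3 u)\<^sup>2"] ell_diag[of "(th4 u)\<^sup>2"] th3_pos[OF that] th4_pos[OF that]
      by (simp_all add: G_def)
  qed
  have "(G \<longlongrightarrow> pi) at_top"
  proof (rule tendsto_sandwich[of "\<lambda>u. pi / (th3 u)\<^sup>2" _ _ "\<lambda>u. pi / (th4 u)\<^sup>2"])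
    show "((\<lambda>u. pi / (th3 u)\<^sup>2) \<longlongrightarrow> pi) at_top" "((\<lambda>u. pi / (th4 u)\<^sup>2) \<longlongrightarrow> pi) at_top"
      by (auto intro!: tendsto_eq_intros th3_tendsto_1 th4_tendsto_1)
    show "eventually (\<lambda>u. pi / (th3 u)\<^sup>2 \<le> G u) at_top" "eventually (\<lambda>u. G u \<le> pi / (th4 u)\<^sup>2) at_top"
      using eventually_gt_at_top[of 0] by (eventually_elim; simp add: bounds)+
  qed
  from filterlim_compose[OF this dyadic_at_top[OF assms]]
  have "(\<lambda>n::nat. G s) \<longlonglongrightarrow> pi" by (simp add: Gn)
  thus ?thesis by (simp add: G_def LIMSEQ_const_iff)
qed

lemma th2_less_th3: "s > 0 \<Longrightarrow> th2 s < th3 s"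
proof -
  assume s: "s > 0"
  have "(th2 s) ^ 4 < (th3 s) ^ 4"
    using th_quartic[OF s] th4_pos[OF s] by simp
  thus ?thesis using th3_pos[OF s] by (simp add: power_less_imp_less_base)
qed

text \<open>The AGM step now leads from \<open>2 s\<close> back to \<open>s\<close> with both means
  halved, so the integral doubles along with \<open>s\<close>. The logarithmic estimate gives
  \<open>th3 u^2 * H u = u + O(1)\<close>; dividing by \<open>2^n\<close> at
  \<open>u = 2^n s\<close> removes the error.\<close>

lemma ell_th3_th2:
  assumes "s > 0"
  shows "ell ((th3 s)\<^sup>2) ((th2 s)\<^sup>2) = s"
proof -
  define H where "H s = ell ((th3 s)\<^sup>2) ((th2 s)\<^sup>2)" for s
  have H2: "H (2 * s) = 2 * H s" if "s > 0" for s
  proof -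
    have "((th3 (2 * s))\<^sup>2 + (th2 (2 * s))\<^sup>2) / 2 = 1 / 2 * (th3 s)\<^sup>2"
      using th3_square[OF that] by simp
    moreover have "sqrt ((th3 (2 * s))\<^sup>2 * (th2 (2 * s))\<^sup>2) = 1 / 2 * (th2 s)\<^sup>2"
      using th2_square[OF that] th3_pos[of "2 * s"] th2_pos[of "2 * s"] that by (simp add: real_sqrt_mult)
    moreover have "(th3 s)\<^sup>2 > 0" "(th2 s)\<^sup>2 > 0" "(th3 (2 * s))\<^sup>2 > 0" "(th2 (2 * s))\<^sup>2 > 0"
      using th3_pos[of "2 * s"] th2_pos[of "2 * s"] th3_pos[of s] th2_pos[of s] that by simp_all
    ultimately have "H (2 * s) = ell (1 / 2 * (th3 s)\<^sup>2) (1 / 2 * (th2 s)\<^sup>2)"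
      unfolding H_def using ell_agm by metis
    also have "\<dots> = 2 * H s"
      using ell_scale[of "(th3 s)\<^sup>2" "(th2 s)\<^sup>2" "1 / 2"] th3_pos[OF that] th2_pos[OF that]
      by (simp add: H_def)
    finally show ?thesis .
  qed
  have Hn: "H (2 ^ n * s) = 2 ^ n * H s" for n
    using assms by (induction n) (simp_all add: H2 mult.assoc)
  \<comment> \<open>The 13 is the 12 of the logarithmic estimate plus 1 from the
    \<open>u - 1\<close> in \<open>th2_le\<close>.\<close>
  define M where "M = 13 + 4 * \<bar>ln (th2 1)\<bar> + 4 * ln (th3 1)"
  have est: "\<bar>(th3 u)\<^sup>2 * H u - u\<bar> \<le> M" if "u \<ge> 1" for u
  proof -
    have u: "u > 0" using that by simp
    define e where "e = (th2 u)\<^sup>2 / (th3 u)\<^sup>2"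
    have e: "0 < e" "e \<le> 1"
      using th2_pos[OF u] th3_pos[OF u] th2_less_th3[OF u] by (simp_all add: e_def power_mono)
    have "(th3 u)\<^sup>2 * H u = ell 1 e"
      using ell_scale[of 1 e "(th3 u)\<^sup>2"] e th3_pos[OF u] by (simp add: H_def e_def)
    moreover have "ln e = 2 * ln (th2 u) - 2 * ln (th3 u)"
      using th2_pos[OF u] th3_pos[OF u] by (simp add: e_def ln_div ln_realpow)
    moreover have "0 \<le> ln (th3 u)" using th3_ge_1[OF u] by simp
    moreover have "ln (th3 u) \<le> ln (th3 1)"
    proof -
      have "exp (1 - u) * (th3 1 - 1) \<le> 1 * (th3 1 - 1)"
        using that th3_ge_1[of 1] by (intro mult_right_mono) auto
      thus ?thesis using th3_le[OF that] th3_pos[OF u] by simp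
    qed
    moreover have "- (u / 4) \<le> ln (th2 u)"
      using th2_ge[OF u] th2_pos[OF u] by (simp add: ln_ge_iff)
    moreover have "ln (th2 u) \<le> - ((u - 1) / 4) + ln (th2 1)"
    proof -
      have "ln (th2 u) \<le> ln (exp (- ((u - 1) / 4)) * th2 1)"
        using th2_le[OF that] th2_pos[OF u] th2_pos[of 1] by (subst ln_le_cancel_iff) auto
      thus ?thesis using th2_pos[of 1] by (simp add: ln_mult)
    qed
    ultimately show ?thesis
      using ell_log_asymptotics[OF e] unfolding M_def by argo
  qed
  have "eventually (\<lambda>n. norm ((th3 (2 ^ n * s))\<^sup>2 * H s - s) \<le> M * (1 / 2) ^ n) sequentially"
  proof -
    have "eventually (\<lambda>n. 2 ^ n * s \<ge> 1) sequentially"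
      using dyadic_at_top[OF assms] by (simp add: filterlim_at_top)
    thus ?thesis
    proof eventually_elim
      case (elim n)
      have "(th3 (2 ^ n * s))\<^sup>2 * H (2 ^ n * s) - 2 ^ n * s = 2 ^ n * ((th3 (2 ^ n * s))\<^sup>2 * H s - s)"
        unfolding Hn by (simp add: algebra_simps)
      with est[OF elim] have "2 ^ n * \<bar>(th3 (2 ^ n * s))\<^sup>2 * H s - s\<bar> \<le> M"
        by (simp only: abs_mult) simp
      thus ?case by (simp add: field_simps power_one_over)
    qed
  qed
  moreover have "(\<lambda>n. M * (1 / 2) ^ n) \<longlonglongrightarrow> 0"
    by (intro tendsto_mult_right_zero LIMSEQ_power_zero) simp
  ultimately have lim: "(\<lambda>n. (th3 (2 ^ n * s))\<^sup>2 * H s - s) \<longlonglongrightarrow> 0"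
    by (rule Lim_null_comparison)
  have "(\<lambda>n. (th3 (2 ^ n * s))\<^sup>2 * H s - s) \<longlonglongrightarrow> 1\<^sup>2 * H s - s"
    by (intro tendsto_intros filterlim_compose[OF th3_tendsto_1 dyadic_at_top[OF assms]])
  from LIMSEQ_unique[OF this lim] show ?thesis
    by (simp add: H_def)
qed

text \<open>By homogeneity the two evaluations become those of \<open>2 K'\<close> and
  \<open>2 K\<close> for the modulus \<open>k\<close> and complementary modulus \<open>k'\<close> at
  nome \<open>exp (- s)\<close>; thus \<open>s = \<pi> K' / K\<close>.\<close>

lemma ell_modulus:
  assumes "s > 0"
  defines "k \<equiv> (th2 s)\<^sup>2 / (th3 s)\<^sup>2" and "k' \<equiv> (th4 s)\<^sup>2 / (th3 s)\<^sup>2"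
  shows "ell 1 k = s * (th3 s)\<^sup>2" "ell 1 k' = pi * (th3 s)\<^sup>2" "0 < k" "0 < k'" "k\<^sup>2 + k'\<^sup>2 = 1"
proof -
  note pos = th2_pos[OF assms(1)] th3_pos[OF assms(1)] th4_pos[OF assms(1)]
  show k: "0 < k" "0 < k'" using pos by (simp_all add: k_def k'_def)
  show "ell 1 k = s * (th3 s)\<^sup>2"
    using ell_scale[of 1 k "(th3 s)\<^sup>2"] ell_th3_th2[OF assms(1)] k pos by (simp add: k_def field_simps)
  show "ell 1 k' = pi * (th3 s)\<^sup>2"
    using ell_scale[of 1 k' "(th3 s)\<^sup>2"] ell_th3_th4[OF assms(1)] k pos by (simp add: k'_def field_simps)
  have "k\<^sup>2 + k'\<^sup>2 = ((th4 s) ^ 4 + (th2 s) ^ 4) / (th3 s) ^ 4"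
    by (simp add: k_def k'_def power_divide add_divide_distrib)
  thus "k\<^sup>2 + k'\<^sup>2 = 1"
    unfolding th_quartic[OF assms(1), symmetric] using pos by simp
qed

text \<open>Everything rests on \<open>k s' = l s\<close>. If it failed,
  \<open>k^2 + l^2 = 1\<close> would order \<open>k s\<close> and \<open>l s'\<close> in the same
  sense, and strict monotonicity would make both integrals on one side of \<open>prod\<close> exceed
  those on the other.\<close>

theorem theta_inversion:
  assumes "s > 0" "s * s' = pi\<^sup>2"
  shows "th3 s' = sqrt (s / pi) * th3 s" "th2 s' = sqrt (s / pi) * th4 s" "th4 s' = sqrt (s / pi) * th2 s"
proof -
  have s': "s' > 0" using assms by (metis pi_gt_zero zero_less_mult_pos zero_less_power)
  define k where "k u = (th2 u)\<^sup>2 / (th3 u)\<^sup>2" for u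
  define l where "l u = (th4 u)\<^sup>2 / (th3 u)\<^sup>2" for u
  note m = ell_modulus[OF assms(1), folded k_def l_def] and m' = ell_modulus[OF s', folded k_def l_def]
  have less: "x < y" if "0 < z" "z < w" "x\<^sup>2 + w\<^sup>2 = 1" "y\<^sup>2 + z\<^sup>2 = 1" "0 < y" for x y z w :: real
  proof -
    have "z\<^sup>2 < w\<^sup>2" using that by (intro power_strict_mono) auto
    hence "x\<^sup>2 < y\<^sup>2" using that by linarith
    thus ?thesis using \<open>0 < y\<close> by (simp add: power_less_imp_less_base)
  qed
  \<comment> \<open>Both sides equal \<open>\<pi>^2 (th3 s)^2 (th3 s')^2\<close>.\<close>
  have prod: "ell 1 (k s) * ell 1 (k s') = ell 1 (l s) * ell 1 (l s')"
    using assms(2) by (simp add: m m' power2_eq_square algebra_simps)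
  have pos: "0 < ell 1 (k s)" "0 < ell 1 (k s')" "0 < ell 1 (l s)" "0 < ell 1 (l s')"
    using th3_pos[OF assms(1)] th3_pos[OF s'] s' assms(1) by (simp_all add: m m')
  have "k s' = l s"
  proof (rule ccontr)
    assume "k s' \<noteq> l s"
    then consider "k s' < l s" | "l s < k s'" by linarith
    thus False
    proof cases
      case 1
      hence "k s < l s'" using less[OF m'(3) 1 m(5) _ m'(4)] m'(5) by (simp add: add.commute)
      with 1 have "ell 1 (l s') < ell 1 (k s)" "ell 1 (l s) < ell 1 (k s')"
        using m(3) m'(3) by (simp_all add: ell_strict_antimono)
      from mult_strict_mono[OF this] pos prod show False by (simp add: mult.commute)
    next
      case 2
      hence "l s' < k s" using less[OF m(4) 2 _ m(5) m(3)] m'(5) by (simp add: add.commute)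
      with 2 have "ell 1 (k s) < ell 1 (l s')" "ell 1 (k s') < ell 1 (l s)"
        using m(4) m'(4) by (simp_all add: ell_strict_antimono)
      from mult_strict_mono[OF this] pos prod show False by (simp add: mult.commute)
    qed
  qed
  hence "(l s')\<^sup>2 = (k s)\<^sup>2" using m(5) m'(5) by simp
  hence kl: "l s' = k s" using power2_eq_iff_nonneg[of "l s'" "k s"] m(3) m'(4) by simp
  have sq3: "(th3 s')\<^sup>2 = s / pi * (th3 s)\<^sup>2"
    using m(1) m'(2) unfolding kl by (simp add: field_simps)
  have sq2: "(th2 s')\<^sup>2 = s / pi * (th4 s)\<^sup>2"
    using \<open>k s' = l s\<close> sq3 th3_pos[OF assms(1)] th3_pos[OF s'] assms(1) by (simp add: k_def l_def field_simps)
  have sq4: "(th4 s')\<^sup>2 = s / pi * (th2 s)\<^sup>2"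
    using kl sq3 th3_pos[OF assms(1)] th3_pos[OF s'] assms(1) by (simp add: k_def l_def field_simps)
  have root: "x = sqrt c * y" if "x\<^sup>2 = c * y\<^sup>2" "0 < x" "0 < y" for x y c :: real
    using that by (metis abs_of_pos real_sqrt_abs real_sqrt_mult)
  show "th3 s' = sqrt (s / pi) * th3 s" "th2 s' = sqrt (s / pi) * th4 s" "th4 s' = sqrt (s / pi) * th2 s"
    using root[OF sq3] root[OF sq2] root[OF sq4] assms(1) s' by (auto simp: th2_pos th3_pos th4_pos)
qed

section \<open>The cubic identity for Eisenstein integers\<close>

text \<open>The pair \<open>(m, n)\<close> stands for \<open>m + n \<omega>\<close> with \<open>\<omega>\<close> a primitive cube root of unity. Since
  \<open>\<omega> \<equiv> 1\<close> modulo \<open>sqrt (-3)\<close>, the residue class modulo \<open>sqrt (-3)\<close> is \<open>m + n\<close> modulo 3.\<close>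

definition eis_norm :: "int \<times> int \<Rightarrow> int" where
  "eis_norm = (\<lambda>(m, n). m * m - m * n + n * n)"

definition eis_exp :: "real \<Rightarrow> int \<times> int \<Rightarrow> real" where
  "eis_exp s x = exp (- (s * of_int (eis_norm x)))"

definition eis_class :: "int \<times> int \<Rightarrow> int" where
  "eis_class = (\<lambda>(m, n). m + n)"

definition eis_theta :: "real \<Rightarrow> real" where
  "eis_theta s = th2 s * th2 (3 * s) + th3 s * th3 (3 * s)"

text \<open>For \<open>q = exp (- s)\<close> the classes 0 and 1 give the Borwein functions
  \<open>a(q^3)\<close> and \<open>c(q^3)\<close>.\<close>

definition eis_coset :: "real \<Rightarrow> int \<Rightarrow> real" where
  "eis_coset s i = (\<Sum>\<^sub>\<infinity>x | eis_class x mod 3 = i. eis_exp s x)"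

text \<open>Completing the square, \<open>m^2 - m n + n^2 = (m - n/2)^2 + 3 (n/2)^2\<close>: even
  \<open>n\<close> gives integer pairs and the \<open>th3\<close> product, odd \<open>n\<close>
  half-integer pairs and the \<open>th2\<close> product.\<close>

lemma has_sum_eis_theta:
  assumes "s > 0"
  shows "(eis_exp s has_sum eis_theta s) UNIV"
proof -
  have even: "(eis_exp s has_sum th3 s * th3 (3 * s)) {(m, n). even n}"
  proof -
    have "((\<lambda>(k, l). exp (- (s * (of_int k)\<^sup>2)) * exp (- (3 * s * (of_int l)\<^sup>2))) has_sum th3 s * th3 (3 * s))
        (UNIV \<times> UNIV)"
      using assms by (intro has_sum_Times_mult has_sum_th3) auto
    thus ?thesis
      by (rule has_sum_reindex_bij_witness[of _ "\<lambda>(m, n). (m - n div 2, n div 2)" "\<lambda>(k, l). (k + l, 2 * l)", THEN iffD1, rotated -1])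
        (auto simp: eis_exp_def eis_norm_def power2_eq_square algebra_simps simp flip: exp_add)
  qed
  have odd: "(eis_exp s has_sum th2 s * th2 (3 * s)) {(m, n). odd n}"
  proof -
    have "((\<lambda>(k, l). exp (- (s * (of_int k + 1/2)\<^sup>2)) * exp (- (3 * s * (of_int l + 1/2)\<^sup>2)))
        has_sum th2 s * th2 (3 * s)) (UNIV \<times> UNIV)"
      using assms by (intro has_sum_Times_mult has_sum_th2) auto
    thus ?thesis
      by (rule has_sum_reindex_bij_witness[of _ "\<lambda>(m, n). (m - n div 2 - 1, n div 2)" "\<lambda>(k, l). (k + l + 1, 2 * l + 1)", THEN iffD1, rotated -1])
        (auto simp: eis_exp_def eis_norm_def power2_eq_square algebra_simps simp flip: exp_add elim!: oddE)
  qed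
  have "{(m, n). even n} \<union> {(m, n). odd n} = (UNIV :: (int \<times> int) set)" by auto
  moreover have "(eis_exp s has_sum (th3 s * th3 (3 * s) + th2 s * th2 (3 * s))) ({(m, n). even n} \<union> {(m, n). odd n})"
    by (rule has_sum_Un_disjoint[OF even odd]) auto
  ultimately show ?thesis by (simp add: eis_theta_def add.commute)
qed

lemma eis_exp_summable: "s > 0 \<Longrightarrow> eis_exp s summable_on A"
  by (rule summable_on_subset[OF has_sum_imp_summable[OF has_sum_eis_theta]]) auto

lemma has_sum_eis_coset: "s > 0 \<Longrightarrow> (eis_exp s has_sum eis_coset s i) {x. eis_class x mod 3 = i}"
  unfolding eis_coset_def by (intro has_sum_infsum eis_exp_summable)

text \<open>Multiplication by \<open>sqrt (-3) = 1 + 2 \<omega>\<close>.\<close>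

lemma eis_coset_0:
  assumes "s > 0"
  shows "eis_coset s 0 = eis_theta (3 * s)"
proof -
  let ?j = "\<lambda>(a, b). (a - 2 * b, 2 * a - b)" and ?i = "\<lambda>(m, n). ((2 * n - m) div 3, (n - 2 * m) div 3)"
  have "(eis_exp (3 * s) has_sum eis_theta (3 * s)) UNIV"
    using assms by (intro has_sum_eis_theta) auto
  also have "?this \<longleftrightarrow> (eis_exp s has_sum eis_theta (3 * s)) {x. eis_class x mod 3 = 0}"
  proof (rule has_sum_reindex_bij_witness[of _ ?i ?j])
    show "?i (?j p) = p" "?j p \<in> {x. eis_class x mod 3 = 0}" "eis_exp s (?j p) = eis_exp (3 * s) p" for p
      by (auto simp: eis_exp_def eis_norm_def eis_class_def algebra_simps split: prod.splits)
    fix p assume "p \<in> {x. eis_class x mod 3 = 0}"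
    moreover obtain m n where p: "p = (m, n)" by (cases p)
    ultimately have "(m + n) mod 3 = 0" by (simp add: eis_class_def)
    then obtain q where "m + n = 3 * q" by (auto elim: dvdE simp: mod_eq_0_iff_dvd)
    hence n: "n = 3 * q - m" by simp
    have "2 * n - m = 3 * (2 * q - m)" "n - 2 * m = 3 * (q - m)" by (simp_all add: n)
    hence "(2 * n - m) div 3 - 2 * ((n - 2 * m) div 3) = m" "2 * ((2 * n - m) div 3) - (n - 2 * m) div 3 = n"
      by (simp_all add: n)
    thus "?j (?i p) = p" by (simp only: p prod.case)
  qed auto
  finally show ?thesis
    using has_sum_eis_coset[OF assms] has_sum_unique by blast
qed

text \<open>Negation preserves the norm and exchanges the classes 1 and 2.\<close>

lemma eis_coset_2:
  assumes "s > 0"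
  shows "eis_coset s 2 = eis_coset s 1"
proof -
  let ?j = "\<lambda>(a::int, b::int). (- a, - b)"
  have j: "eis_class (?j p) = - eis_class p" "eis_exp s (?j p) = eis_exp s p" "?j (?j p) = p" for p
    by (auto simp: eis_class_def eis_exp_def eis_norm_def split: prod.split)
  have neg: "(- k) mod 3 = 1 \<longleftrightarrow> k mod 3 = 2" "(- k) mod 3 = 2 \<longleftrightarrow> k mod 3 = 1" for k :: int
    by (auto simp: zmod_zminus1_eq_if)
  have "(eis_exp s has_sum eis_coset s 1) {x. eis_class x mod 3 = 1}"
    by (rule has_sum_eis_coset[OF assms])
  also have "?this \<longleftrightarrow> (eis_exp s has_sum eis_coset s 1) {x. eis_class x mod 3 = 2}"
    by (rule has_sum_reindex_bij_witness[of _ ?j ?j]) (simp_all only: mem_Collect_eq j neg)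
  finally show ?thesis
    using has_sum_eis_coset[OF assms] has_sum_unique by blast
qed

lemma has_sum_residues:
  assumes "\<And>i::int. i \<in> {0, 1, 2} \<Longrightarrow> (f has_sum (F i :: real)) {x \<in> A. c x mod 3 = i}"
  shows "(f has_sum (F 0 + F 1 + F 2)) A"
proof -
  have "(f has_sum (\<Sum>i\<in>{0, 1, 2}. F i)) (\<Union>i\<in>{0, 1, 2}. {x \<in> A. c x mod 3 = i})"
    using assms by (intro sum_has_sum) auto
  moreover have "(\<Union>i\<in>{0, 1, 2}. {x \<in> A. c x mod 3 = i}) = A"
  proof -
    have "k mod 3 \<in> {0, 1, 2}" for k :: int by auto
    thus ?thesis by blast
  qed
  ultimately show ?thesis by (simp add: add.assoc)
qed

lemma eis_theta_cosets:
  assumes "s > 0"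
  shows "eis_theta s = eis_theta (3 * s) + 2 * eis_coset s 1"
proof -
  have "(eis_exp s has_sum (eis_coset s 0 + eis_coset s 1 + eis_coset s 2)) UNIV"
    by (rule has_sum_residues[where c = eis_class]) (use has_sum_eis_coset[OF assms] in simp)
  thus ?thesis
    using has_sum_eis_theta[OF assms] eis_coset_0[OF assms] eis_coset_2[OF assms] has_sum_unique by fastforce
qed

text \<open>Cyclic convolution modulo 3: pairs with total residue \<open>r\<close> are a disjoint
  union of products of residue classes.\<close>

lemma has_sum_residue_pairs:
  fixes c :: "'a \<Rightarrow> int" and d :: "'b \<Rightarrow> int" and F G :: "int \<Rightarrow> real"
  assumes f: "\<And>i. i \<in> {0, 1, 2} \<Longrightarrow> (f has_sum F i) {x \<in> A. c x mod 3 = i}"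
    and g: "\<And>i. i \<in> {0, 1, 2} \<Longrightarrow> (g has_sum G i) {y \<in> B. d y mod 3 = i}"
    and r: "r \<in> {0, 1, 2}"
  shows "((\<lambda>(x, y). f x * g y) has_sum (\<Sum>i\<in>{0, 1, 2}. F i * G ((r - i) mod 3)))
           {(x, y) \<in> A \<times> B. (c x + d y) mod 3 = r}"
proof -
  have mod3: "k mod 3 \<in> {0, 1, 2}" for k :: int by auto
  have "((\<lambda>(x, y). f x * g y) has_sum (\<Sum>i\<in>{0, 1, 2}. F i * G ((r - i) mod 3)))
      (\<Union>i\<in>{0, 1, 2}. {x \<in> A. c x mod 3 = i} \<times> {y \<in> B. d y mod 3 = (r - i) mod 3})"
    by (intro sum_has_sum has_sum_Times_mult f g mod3) auto
  moreover have "(\<Union>i\<in>{0, 1, 2}. {x \<in> A. c x mod 3 = i} \<times> {y \<in> B. d y mod 3 = (r - i) mod 3}) =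
      {(x, y) \<in> A \<times> B. (c x + d y) mod 3 = r}"
  proof -
    have "(k + l) mod 3 = r \<longleftrightarrow> l mod 3 = (r - k mod 3) mod 3" for k l :: int
    proof -
      have "(r - k mod 3) mod 3 = (r - k) mod 3" by (simp add: mod_diff_right_eq)
      moreover have "r = r mod 3" using r by auto
      moreover have "k + l - r = l - (r - k)" by simp
      ultimately show ?thesis by (metis mod_eq_dvd_iff)
    qed
    hence iff: "(k + l) mod 3 = r \<longleftrightarrow> (\<exists>i\<in>{0, 1, 2}. k mod 3 = i \<and> l mod 3 = (r - i) mod 3)" for k l :: int
      using mod3[of k] by metis
    have "(\<Union>i\<in>I. {x \<in> A. c x mod 3 = i} \<times> {y \<in> B. d y mod 3 = (r - i) mod 3}) =
        {(x, y) \<in> A \<times> B. \<exists>i\<in>I. c x mod 3 = i \<and> d y mod 3 = (r - i) mod 3}" for I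
      by blast
    thus ?thesis by (simp only: iff)
  qed
  ultimately show ?thesis by simp
qed

lemma has_sum_residue_triples:
  fixes c :: "'a \<Rightarrow> int" and F :: "int \<Rightarrow> real"
  assumes f: "\<And>i. i \<in> {0, 1, 2} \<Longrightarrow> (f has_sum F i) {x \<in> A. c x mod 3 = i}" and r: "r \<in> {0, 1, 2}"
  shows "((\<lambda>(x, y, z). f x * (f y * f z)) has_sum
      (\<Sum>i\<in>{0, 1, 2}. F i * (\<Sum>j\<in>{0, 1, 2}. F j * F (((r - i) mod 3 - j) mod 3))))
      {(x, y, z) \<in> A \<times> A \<times> A. (c x + (c y + c z)) mod 3 = r}"
proof -
  have "((\<lambda>(x, y). f x * f y) has_sum (\<Sum>j\<in>{0, 1, 2}. F j * F ((i - j) mod 3)))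
      {p \<in> A \<times> A. (\<lambda>(x, y). c x + c y) p mod 3 = i}" if "i \<in> {0, 1, 2}" for i
    using has_sum_residue_pairs[OF f f that] by (simp add: case_prod_unfold mem_Times_iff conj_assoc)
  from has_sum_residue_pairs[OF f this r] show ?thesis
    by (simp add: case_prod_unfold mem_Times_iff conj_assoc)
qed

lemma mod_3_shift: "x = y + 3 * k \<Longrightarrow> x mod 3 = y mod 3" for x :: int
  by simp

lemma mod_3_decomp: "x mod 3 = i \<Longrightarrow> x = i + 3 * (x div 3)" for x :: int
  using mult_div_mod_eq[of 3 x] by simp

text \<open>Elements \<open>1 + sqrt (-3) v\<close> split into three classes modulo 3, which multiplication by \<open>\<omega>\<close> permutes
  cyclically.\<close>

lemma eis_coset_thirds:
  assumes "s > 0" "i \<in> {0, 1, 2}"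
  shows "(eis_exp s has_sum (eis_coset s 1 / 3)) {x \<in> {x. eis_class x mod 3 = 1}. fst x mod 3 = i}"
proof -
  let ?A = "\<lambda>i. {x \<in> {x. eis_class x mod 3 = 1}. fst x mod 3 = i}"
  define K where "K i = (\<Sum>\<^sub>\<infinity>x\<in>?A i. eis_exp s x)" for i
  have K: "(eis_exp s has_sum K i) (?A i)" for i
    unfolding K_def using assms by (intro has_sum_infsum eis_exp_summable)
  have rot: "K (i + 1) = K i" if "i \<in> {0, 1}" for i
  proof -
    have "(eis_exp s has_sum K i) (?A (i + 1)) \<longleftrightarrow> (eis_exp s has_sum K i) (?A i)"
    \<comment> \<open>The maps are multiplication by \<omega>\<omega>, that is by its square, and by
      \<omega>; the latter lowers the first coordinate by 1 modulo 3 within the class.\<close>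
    proof (rule has_sum_reindex_bij_witness[of _ "\<lambda>(a, b). (b - a, - a)" "\<lambda>(a, b). (- b, a - b)"])
      fix p :: "int \<times> int"
      obtain a b where p: "p = (a, b)" by (cases p)
      show "eis_exp s (case p of (a, b) \<Rightarrow> (- b, a - b)) = eis_exp s p"
        by (simp add: p eis_exp_def eis_norm_def algebra_simps)
      show "(case p of (a, b) \<Rightarrow> (- b, a - b)) \<in> ?A i" if "p \<in> ?A (i + 1)"
      proof -
        have "(a + b) mod 3 = 1" "a mod 3 = i + 1" using that by (simp_all add: p eis_class_def)
        then obtain P Q where d: "a + b = 1 + 3 * P" "a = i + 1 + 3 * Q"
          using mod_3_decomp by blast
        hence e: "b = 1 + 3 * P - a" by simp
        have "(- b) mod 3 = i mod 3"
          by (intro mod_3_shift[of _ _ "Q - P"]) (simp add: e d(2))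
        moreover have "(- b + (a - b)) mod 3 = 1 mod 3"
          by (intro mod_3_shift[of _ _ "P - b"]) (simp add: e d(2))
        ultimately show ?thesis using \<open>i \<in> {0, 1}\<close> by (auto simp: p eis_class_def)
      qed
      show "(case p of (a, b) \<Rightarrow> (b - a, - a)) \<in> ?A (i + 1)" if "p \<in> ?A i"
      proof -
        have "(a + b) mod 3 = 1" "a mod 3 = i" using that by (simp_all add: p eis_class_def)
        then obtain P Q where d: "a + b = 1 + 3 * P" "a = i + 3 * Q"
          using mod_3_decomp by blast
        hence e: "b = 1 + 3 * P - a" by simp
        have "(b - a) mod 3 = (i + 1) mod 3"
          by (intro mod_3_shift[of _ _ "P - a + Q"]) (simp add: e d(2))
        moreover have "(b - a + - a) mod 3 = 1 mod 3"
          by (intro mod_3_shift[of _ _ "P - a"]) (simp add: e d(2))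
        ultimately show ?thesis using \<open>i \<in> {0, 1}\<close> by (auto simp: p eis_class_def)
      qed
    qed auto
    thus ?thesis using K has_sum_unique by blast
  qed
  have "(eis_exp s has_sum (K 0 + K 1 + K 2)) {x. eis_class x mod 3 = 1}"
    by (rule has_sum_residues[where c = fst]) (rule K)
  hence "K 0 + K 1 + K 2 = eis_coset s 1"
    using has_sum_eis_coset[OF assms(1)] has_sum_unique by blast
  moreover have "K 1 = K 0" "K 2 = K 1" using rot[of 0] rot[of 1] by simp_all
  ultimately have "eis_coset s 1 / 3 = K i" using assms(2) by auto
  thus ?thesis using K[of i] by (simp only:)
qed

text \<open>The map \<open>(x, y, z) \<mapsto> (x + y + z, x + \<omega> y + \<omega>\<^sup>2 z, x + \<omega>\<^sup>2 y + \<omega> z)\<close> multiplies the total norm by 3. It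
  takes the triples with \<open>x + y + z \<equiv> 1\<close> modulo \<open>sqrt (-3)\<close> onto the triples of elements \<open>\<equiv> 1\<close> whose
  sum is divisible by 3.\<close>

lemma eis_coset_triples:
  assumes "s > 0"
  shows "9 * eis_coset s 1 * ((eis_coset s 0)\<^sup>2 + eis_coset s 0 * eis_coset s 1 + (eis_coset s 1)\<^sup>2)
    = (eis_coset (s / 3) 1) ^ 3"
proof -
  let ?S = "{(x, y, z) \<in> UNIV \<times> UNIV \<times> UNIV. (eis_class x + (eis_class y + eis_class z)) mod 3 = 1}"
  let ?A = "{x. eis_class x mod 3 = 1}"
  let ?T = "{(x, y, z) \<in> ?A \<times> ?A \<times> ?A. (fst x + (fst y + fst z)) mod 3 = 0}"
  let ?f = "\<lambda>s (x, y, z). eis_exp s x * (eis_exp s y * eis_exp s z)"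
  define D where "D = eis_coset s 0"
  define C where "C = eis_coset s 1"
  define E where "E = eis_coset (s / 3) 1"
  have "(eis_exp s has_sum (if i = 0 then D else C)) {x \<in> UNIV. eis_class x mod 3 = i}" if "i \<in> {0, 1, 2}" for i
    using has_sum_eis_coset[OF assms, of i] eis_coset_2[OF assms] that by (auto simp: C_def D_def)
  \<comment> \<open>Residues with sum 1 are the arrangements of 0, 0, 1, of 0, 2, 2 and of 1, 1, 2,
    three each; classes 1 and 2 both contribute \<open>C\<close>.\<close>
  from has_sum_residue_triples[OF this, of 1]
  have 1: "(?f s has_sum (3 * C * (D\<^sup>2 + D * C + C\<^sup>2))) ?S"
    by (simp add: power2_eq_square algebra_simps)
  \<comment> \<open>Nine residue triples have sum 0, and every third contributes
    \<open>E / 3\<close>.\<close>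
  from has_sum_residue_triples[OF eis_coset_thirds[of "s / 3"], of 0]
  have 2: "(?f (s / 3) has_sum (9 * (E / 3) ^ 3)) ?T"
    using assms by (simp add: power3_eq_cube E_def[symmetric])
  define J :: "(int \<times> int) \<times> (int \<times> int) \<times> (int \<times> int) \<Rightarrow> (int \<times> int) \<times> (int \<times> int) \<times> (int \<times> int)"
    where "J = (\<lambda>((a1, b1), (a2, b2), (a3, b3)).
      ((a1 + a2 + a3, b1 + b2 + b3), (a1 - b2 + b3 - a3, b1 + a2 - b2 - a3), (a1 + b2 - a2 - b3, b1 - a2 + a3 - b3)))"
  \<comment> \<open>The inverse discrete Fourier transform \<open>(u + v + w, u + \<omega>^2 v +
    \<omega> w, u + \<omega> v + \<omega>^2 w) / 3\<close>, whose divisions are exact on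
    \<open>?T\<close>.\<close>
  define I :: "(int \<times> int) \<times> (int \<times> int) \<times> (int \<times> int) \<Rightarrow> (int \<times> int) \<times> (int \<times> int) \<times> (int \<times> int)"
    where "I = (\<lambda>((u1, u2), (v1, v2), (w1, w2)).
      (((u1 + v1 + w1) div 3, (u2 + v2 + w2) div 3),
       ((u1 + v2 - v1 - w2) div 3, (u2 - v1 + w1 - w2) div 3),
       ((u1 - v2 + w2 - w1) div 3, (u2 + v1 - v2 - w1) div 3)))"
  have J: "J ((a1, b1), (a2, b2), (a3, b3)) =
      ((a1 + a2 + a3, b1 + b2 + b3), (a1 - b2 + b3 - a3, b1 + a2 - b2 - a3), (a1 + b2 - a2 - b3, b1 - a2 + a3 - b3))"
    for a1 b1 a2 b2 a3 b3 by (simp add: J_def)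
  have I: "I ((u1, u2), (v1, v2), (w1, w2)) =
      (((u1 + v1 + w1) div 3, (u2 + v2 + w2) div 3),
       ((u1 + v2 - v1 - w2) div 3, (u2 - v1 + w1 - w2) div 3),
       ((u1 - v2 + w2 - w1) div 3, (u2 + v1 - v2 - w1) div 3))"
    for u1 u2 v1 v2 w1 w2 by (simp add: I_def)
  have div3: "k div 3 = l" if "k = 3 * l" for k l :: int using that by simp
  have IJ: "I (J p) = p" for p
  proof -
    obtain a1 b1 a2 b2 a3 b3 where p: "p = ((a1, b1), (a2, b2), (a3, b3))" by (metis prod.exhaust)
    show ?thesis unfolding p J I by (intro arg_cong2[of _ _ _ _ Pair] div3) simp_all
  qed
  have JI: "J (I p) = p" if "p \<in> ?T" for p
  proof -
    obtain u1 u2 v1 v2 w1 w2 where p: "p = ((u1, u2), (v1, v2), (w1, w2))" by (metis prod.exhaust)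
    have *: "(u1 + u2) mod 3 = 1" "(v1 + v2) mod 3 = 1" "(w1 + w2) mod 3 = 1" "(u1 + v1 + w1) mod 3 = 0"
      using that by (auto simp: p eis_class_def add.assoc)
    \<comment> \<open>These quotients solve the congruences, so that each numerator in
      \<open>I\<close> becomes a visible multiple of 3.\<close>
    define q r t z where "q = (u1 + u2) div 3" and "r = (v1 + v2) div 3" and "t = (w1 + w2) div 3"
      and "z = (u1 + v1 + w1) div 3"
    have d: "u1 + u2 = 1 + 3 * q" "v1 + v2 = 1 + 3 * r" "w1 + w2 = 1 + 3 * t" "u1 + v1 + w1 = 0 + 3 * z"
      using * by (simp_all only: q_def r_def t_def z_def mod_3_decomp)
    have e: "u1 = 3 * z - v1 - w1" "u2 = 1 + 3 * q - u1" "v2 = 1 + 3 * r - v1" "w2 = 1 + 3 * t - w1"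
      using d by simp_all
    have "(u1 + v1 + w1) div 3 = z" "(u2 + v2 + w2) div 3 = q + r + t + 1 - z"
      "(u1 + v2 - v1 - w2) div 3 = z - v1 + r - t" "(u2 - v1 + w1 - w2) div 3 = q - t - z + w1"
      "(u1 - v2 + w2 - w1) div 3 = z - w1 + t - r" "(u2 + v1 - v2 - w1) div 3 = q - r - z + v1"
      by (rule div3, simp add: e)+
    thus ?thesis unfolding p I J using d by (intro arg_cong2[of _ _ _ _ Pair]; linarith)
  qed
  have JT: "J p \<in> ?T \<longleftrightarrow> p \<in> ?S" for p
  proof -
    obtain a1 b1 a2 b2 a3 b3 where p: "p = ((a1, b1), (a2, b2), (a3, b3))" by (metis prod.exhaust)
    have "(a1 - b2 + b3 - a3 + (b1 + a2 - b2 - a3)) mod 3 = (a1 + b1 + a2 + b2 + a3 + b3) mod 3"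
      "(a1 + b2 - a2 - b3 + (b1 - a2 + a3 - b3)) mod 3 = (a1 + b1 + a2 + b2 + a3 + b3) mod 3"
      "(a1 + a2 + a3 + (a1 - b2 + b3 - a3 + (a1 + b2 - a2 - b3))) mod 3 = 0 mod 3"
      by (rule mod_3_shift[of _ _ "- b2 - a3"] mod_3_shift[of _ _ "- a2 - b3"] mod_3_shift[of _ _ a1]; simp)+
    thus ?thesis unfolding p J eis_class_def by (simp add: add_ac)
  qed
  have fJ: "?f (s / 3) (J p) = ?f s p" for p
  proof -
    obtain a1 b1 a2 b2 a3 b3 where p: "p = ((a1, b1), (a2, b2), (a3, b3))" by (metis prod.exhaust)
    show ?thesis unfolding p J prod.case eis_exp_def eis_norm_def exp_add[symmetric]
      by (rule arg_cong[of _ _ exp]) (simp add: field_simps)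
  qed
  have "(?f s has_sum (9 * (E / 3) ^ 3)) ?S \<longleftrightarrow> (?f (s / 3) has_sum (9 * (E / 3) ^ 3)) ?T"
    by (rule has_sum_reindex_bij_witness[of _ I J]) (simp_all only: IJ JI JT fJ flip: JT)
  with 1 2 have "3 * C * (D\<^sup>2 + D * C + C\<^sup>2) = 9 * (E / 3) ^ 3"
    using has_sum_unique by blast
  thus ?thesis
    unfolding C_def[symmetric] D_def[symmetric] E_def[symmetric] by (simp add: power3_eq_cube)
qed

text \<open>In the coset sums, \<open>a = D + 2 C\<close> and \<open>b = D - C\<close>, so
  \<open>a^3 - b^3 = 9 C (D^2 + D C + C^2)\<close>, which the triple identity recognises as
  \<open>c^3\<close>.\<close>

theorem borwein_cubic:
  assumes "s > 0"
  defines "b \<equiv> (3 * eis_theta (3 * s) - eis_theta s) / 2"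
    and "c \<equiv> (eis_theta (s / 3) - eis_theta s) / 2"
  shows "(eis_theta s) ^ 3 = b ^ 3 + c ^ 3"
proof -
  define D where "D = eis_coset s 0"
  define C where "C = eis_coset s 1"
  have A: "eis_theta s = D + 2 * C"
    using eis_theta_cosets[OF assms(1)] eis_coset_0[OF assms(1)] by (simp add: C_def D_def)
  have b: "b = D - C"
    using A eis_coset_0[OF assms(1)] by (simp add: b_def D_def)
  have c: "c = eis_coset (s / 3) 1"
    using eis_theta_cosets[of "s / 3"] assms(1) by (simp add: c_def)
  have "(D + 2 * C) ^ 3 - (D - C) ^ 3 = 9 * C * (D\<^sup>2 + D * C + C\<^sup>2)"
    by (simp add: power3_eq_cube power2_eq_square algebra_simps)
  thus ?thesis
    using eis_coset_triples[OF assms(1)] by (simp add: A b c C_def D_def)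
qed

section \<open>The value at the singular point\<close>

text \<open>Inversion leads to \<open>th3\<close> and \<open>th4\<close> at \<open>3 u / 4\<close>
  and \<open>u / 4\<close>; the parity splittings return to \<open>3 u\<close> and \<open>u\<close>,
  where the mixed products cancel.\<close>

lemma eis_theta_inversion:
  assumes "u > 0"
  shows "eis_theta (4 * pi\<^sup>2 / (3 * u)) = sqrt 3 * u / (2 * pi) * eis_theta u"
proof -
  define A where "A = sqrt (3 * u / 4 / pi)"
  define B where "B = sqrt (u / 4 / pi)"
  have A: "th3 (4 * pi\<^sup>2 / (3 * u)) = A * th3 (3 * u / 4)" "th2 (4 * pi\<^sup>2 / (3 * u)) = A * th4 (3 * u / 4)"
    using theta_inversion[of "3 * u / 4" "4 * pi\<^sup>2 / (3 * u)"] assms by (simp_all add: A_def)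
  have B: "th3 (3 * (4 * pi\<^sup>2 / (3 * u))) = B * th3 (u / 4)" "th2 (3 * (4 * pi\<^sup>2 / (3 * u))) = B * th4 (u / 4)"
    using theta_inversion[of "u / 4" "3 * (4 * pi\<^sup>2 / (3 * u))"] assms by (simp_all add: B_def)
  have "A * B = sqrt (3 * (u / (4 * pi))\<^sup>2)"
    unfolding A_def B_def real_sqrt_mult[symmetric] by (simp add: power2_eq_square)
  hence AB: "A * B = sqrt 3 * u / (4 * pi)"
    using assms by (simp add: real_sqrt_mult)
  have "eis_theta (4 * pi\<^sup>2 / (3 * u)) =
      A * B * (th4 (3 * u / 4) * th4 (u / 4) + th3 (3 * u / 4) * th3 (u / 4))"
    unfolding eis_theta_def A B by (simp add: algebra_simps)
  also have "th4 (3 * u / 4) * th4 (u / 4) + th3 (3 * u / 4) * th3 (u / 4) = 2 * eis_theta u"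
  proof -
    have "th3 (3 * u / 4) = th3 (3 * u) + th2 (3 * u)" "th4 (3 * u / 4) = th3 (3 * u) - th2 (3 * u)"
      "th3 (u / 4) = th3 u + th2 u" "th4 (u / 4) = th3 u - th2 u"
      using th3_split[of "3 * u / 4"] th4_split[of "3 * u / 4"] th3_split[of "u / 4"] th4_split[of "u / 4"] assms
      by simp_all
    thus ?thesis by (simp only: eis_theta_def) (simp add: algebra_simps)
  qed
  finally show ?thesis by (simp add: AB)
qed

text \<open>The point \<open>\<sigma>' = \<sigma> / 3\<close> is also the image of
  \<open>\<sigma>\<close> under inversion, so the modular equation of degree 3 relates theta
  constants at \<open>\<sigma>\<close> alone: \<open>z^2 = 2 x y\<close>, that is
  \<open>k k' = 1/4\<close>.\<close>

lemma
  defines "\<sigma> \<equiv> pi * sqrt 3" and "\<sigma>' \<equiv> pi / sqrt 3"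
  shows th3_singular: "(th3 \<sigma>)\<^sup>2 = 3 powr (-3/4) * Beta (1/6) (1/2) / pi"
    and eis_theta_singular_th3: "eis_theta (2 * \<sigma>') = 3 powr (3/4) / 2 * (th3 \<sigma>)\<^sup>2"
proof -
  have \<sigma>: "\<sigma> > 0" "\<sigma>' > 0" "\<sigma> * \<sigma>' = pi\<^sup>2" "\<sigma> / pi = sqrt 3" "3 * \<sigma>' = \<sigma>"
    by (simp_all add: \<sigma>_def \<sigma>'_def power2_eq_square field_simps)
  define x y z where "x = th2 \<sigma>" and "y = th4 \<sigma>" and "z = th3 \<sigma>"
  have pos: "x > 0" "y > 0" "z > 0"
    using \<sigma> by (simp_all add: x_def y_def z_def th2_pos th3_pos th4_pos)
  define t where "t = sqrt (sqrt 3)"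
  have t: "t > 0" "t\<^sup>2 = sqrt 3" by (simp_all add: t_def)
  note inv = theta_inversion[OF \<sigma>(1,3), unfolded \<sigma>(4), folded t_def x_def y_def z_def]
  have z2: "z\<^sup>2 = 2 * x * y"
  proof -
    have "t * z\<^sup>2 = t * (2 * x * y)"
      using th_cubic_modular[OF \<sigma>(2)] unfolding \<sigma>(5) inv x_def[symmetric] y_def[symmetric] z_def[symmetric]
      by (simp add: power2_eq_square algebra_simps)
    thus ?thesis using t by simp
  qed
  have z4: "z ^ 4 = y ^ 4 + x ^ 4"
    unfolding x_def y_def z_def by (rule th_quartic[OF \<sigma>(1)])
  define k k' where "k = x\<^sup>2 / z\<^sup>2" and "k' = y\<^sup>2 / z\<^sup>2"
  note m = ell_modulus[OF \<sigma>(1), folded x_def y_def z_def, folded k_def k'_def]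
  have "k * k' = (x * y / z\<^sup>2)\<^sup>2" by (simp add: k_def k'_def power_divide power_mult_distrib power2_eq_square)
  also have "x * y / z\<^sup>2 = 1 / 2" using pos by (simp add: z2)
  finally have kk': "k * k' = 1 / 4" by (simp add: power2_eq_square)
  \<comment> \<open>The relations found are symmetric in the two moduli; the ratio
    \<open>\<sigma> / \<pi> > 1\<close> of the integrals tells which is smaller.\<close>
  have "k < k'"
  proof (rule ccontr)
    assume "\<not> k < k'"
    hence "ell 1 k \<le> ell 1 k'" using m(4) by (intro ell_antimono) auto
    moreover have "\<sigma> > pi" by (simp add: \<sigma>_def)
    ultimately show False using m(1,2) pos by simp
  qed
  hence k2: "k\<^sup>2 < k'\<^sup>2" using m(3) by (intro power_strict_mono) auto
  have "(k'\<^sup>2 - k\<^sup>2)\<^sup>2 = (k\<^sup>2 + k'\<^sup>2)\<^sup>2 - 4 * (k * k')\<^sup>2"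
    by (simp add: power2_eq_square algebra_simps)
  also have "\<dots> = 3 / 4" unfolding m(5) kk' by (simp add: power2_eq_square)
  finally have "k'\<^sup>2 - k\<^sup>2 = sqrt (3 / 4)" using k2 by (intro real_sqrt_unique[symmetric]) auto
  hence "k'\<^sup>2 = (2 + sqrt 3) / 4" using m(5) by (simp add: real_sqrt_divide)
  from ell_singular[OF m(4) this] m(2)
  show "(th3 \<sigma>)\<^sup>2 = 3 powr (-3/4) * Beta (1/6) (1/2) / pi"
    by (simp add: z_def field_simps)
  \<comment> \<open>The squaring formulas reach only \<open>P^2\<close> and \<open>Q^2\<close>. So
    \<open>P + Q\<close>, the wanted value, is found from \<open>P^2 + Q^2\<close> and
    \<open>P Q\<close>, with positivity fixing the root.\<close>
  define P Q where "P = th3 (2 * \<sigma>') * th3 (2 * \<sigma>)" and "Q = th2 (2 * \<sigma>') * th2 (2 * \<sigma>)"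
  have PQ: "P > 0" "Q > 0" using \<sigma> by (simp_all add: P_def Q_def th2_pos th3_pos)
  have sq: "(th3 (2 * \<sigma>))\<^sup>2 = (z\<^sup>2 + y\<^sup>2) / 2" "(th2 (2 * \<sigma>))\<^sup>2 = (z\<^sup>2 - y\<^sup>2) / 2"
    using th3_square[OF \<sigma>(1)] th4_square[OF \<sigma>(1)] by (simp_all add: y_def z_def)
  have sq': "(th3 (2 * \<sigma>'))\<^sup>2 = sqrt 3 * (z\<^sup>2 + x\<^sup>2) / 2" "(th2 (2 * \<sigma>'))\<^sup>2 = sqrt 3 * (z\<^sup>2 - x\<^sup>2) / 2"
    using th3_square[OF \<sigma>(2)] th4_square[OF \<sigma>(2)] unfolding inv
    by (simp_all add: power_mult_distrib t algebra_simps)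
  have sums: "P\<^sup>2 + Q\<^sup>2 = 5 * sqrt 3 / 8 * (z\<^sup>2)\<^sup>2"
  proof -
    have "P\<^sup>2 + Q\<^sup>2 = sqrt 3 / 2 * ((z\<^sup>2)\<^sup>2 + (x * y)\<^sup>2)"
      unfolding P_def Q_def power_mult_distrib sq sq' by (simp add: field_simps power2_eq_square)
    also have "x * y = z\<^sup>2 / 2" by (simp add: z2)
    finally show ?thesis by (simp add: power2_eq_square field_simps)
  qed
  have prods: "P * Q = sqrt 3 / 16 * (z\<^sup>2)\<^sup>2"
  proof -
    have "(P * Q)\<^sup>2 = 3 / 16 * ((z ^ 4 - y ^ 4) * (z ^ 4 - x ^ 4))"
    proof -
      have "(S * (a + b) / 2 * ((a + c) / 2)) * (S * (a - b) / 2 * ((a - c) / 2)) =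
          S * S / 16 * ((a\<^sup>2 - c\<^sup>2) * (a\<^sup>2 - b\<^sup>2))" for S a b c :: real
        by (simp add: field_simps power2_eq_square)
      from this[of "sqrt 3" "z\<^sup>2" "x\<^sup>2" "y\<^sup>2"] show ?thesis
        unfolding P_def Q_def power_mult_distrib sq sq' by simp
    qed
    \<comment> \<open>By the quartic identity the two differences are \<open>x^4\<close> and
      \<open>y^4\<close>.\<close>
    also have "\<dots> = 3 / 16 * (x * y) ^ 4" by (simp add: z4 power_mult_distrib)
    also have "x * y = z\<^sup>2 / 2" by (simp add: z2)
    also have "3 / 16 * (z\<^sup>2 / 2) ^ 4 = (sqrt 3 / 16 * (z\<^sup>2)\<^sup>2)\<^sup>2"
      by (simp add: power_mult_distrib power_divide)
    finally show ?thesis using PQ pos by (subst (asm) power2_eq_iff_nonneg) auto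
  qed
  have "(P + Q)\<^sup>2 = P\<^sup>2 + Q\<^sup>2 + 2 * (P * Q)" by (simp add: power2_sum)
  also have "\<dots> = 3 * sqrt 3 / 4 * (z\<^sup>2)\<^sup>2" unfolding sums prods by simp
  also have "3 * sqrt 3 = (3 powr (3/4))\<^sup>2"
  proof -
    have "(3 powr (3/4) :: real)\<^sup>2 = 3 powr (1 + 1/2)" by (simp add: power2_eq_square flip: powr_add)
    also have "\<dots> = 3 * sqrt 3" unfolding powr_add by (simp add: powr_half_sqrt)
    finally show ?thesis ..
  qed
  also have "(3 powr (3/4))\<^sup>2 / 4 * (z\<^sup>2)\<^sup>2 = (3 powr (3/4) / 2 * z\<^sup>2)\<^sup>2"
    by (simp add: power_mult_distrib power_divide)
  finally have "P + Q = 3 powr (3/4) / 2 * z\<^sup>2"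
    using PQ by (subst (asm) power2_eq_iff_nonneg) auto
  moreover have "eis_theta (2 * \<sigma>') = P + Q"
    using \<sigma>(5) by (simp add: eis_theta_def P_def Q_def mult.left_commute)
  ultimately show "eis_theta (2 * \<sigma>') = 3 powr (3/4) / 2 * (th3 \<sigma>)\<^sup>2"
    by (simp add: z_def)
qed

lemma eis_theta_singular:
  "eis_theta (2 * pi / sqrt 3) = sqrt 3 / (2 * pi) * (1 / 2 powr (1/3)) * Beta (1/3) (1/3)"
proof -
  have "eis_theta (2 * pi / sqrt 3) =
      (3 powr (3/4) * 3 powr (-3/4)) / (2 * pi) * (2 powr (-1/3) * sqrt 3 * Beta (1/3) (1/3))"
    using eis_theta_singular_th3 by (simp add: th3_singular Beta_sixth_half)
  also have "3 powr (3/4) * 3 powr (-3/4) = (1 :: real)"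
    unfolding powr_add[symmetric] by simp
  finally show ?thesis by (simp add: powr_minus_divide)
qed

text \<open>The point \<open>s\<close> is fixed by \<open>u \<mapsto> 4 \<pi>^2 / (3 u)\<close>,
  which exchanges \<open>3 s\<close> and \<open>s / 3\<close>. Hence \<open>b = c\<close>, and the
  cubic identity reduces to \<open>a^3 = 2 c^3\<close>.\<close>

lemma eis_theta_singular_third:
  defines "s \<equiv> 2 * pi / sqrt 3"
  shows "(eis_theta (s / 3) - eis_theta s) / 2 = eis_theta s / 2 powr (1/3)"
proof -
  define b c where "b = (3 * eis_theta (3 * s) - eis_theta s) / 2" and "c = (eis_theta (s / 3) - eis_theta s) / 2"
  have s: "s > 0" by (simp add: s_def)
  have "4 * pi\<^sup>2 / (3 * (3 * s)) = s / 3"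
    by (simp add: s_def field_simps power2_eq_square)
  from eis_theta_inversion[of "3 * s", unfolded this] s
  have "eis_theta (s / 3) = sqrt 3 * (3 * s) / (2 * pi) * eis_theta (3 * s)"
    by simp
  also have "sqrt 3 * (3 * s) / (2 * pi) = 3" by (simp add: s_def)
  finally have "b = c" by (simp add: b_def c_def)
  hence "(eis_theta s) ^ 3 = 2 * c ^ 3"
    using borwein_cubic[OF s, folded b_def c_def] by simp
  moreover have "(2 powr (1/3)) ^ 3 = (2 :: real)" by (simp add: powr_power)
  ultimately have "c ^ 3 = (eis_theta s / 2 powr (1/3)) ^ 3" by (simp add: power_divide)
  hence "root 3 (c ^ 3) = root 3 ((eis_theta s / 2 powr (1/3)) ^ 3)" by (rule arg_cong)
  hence "c = eis_theta s / 2 powr (1/3)"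
    by (subst (asm) (1 2) odd_real_root_power_cancel) simp_all
  thus ?thesis by (simp add: c_def)
qed

section \<open>Transfer to the complex theta functions on the imaginary axis\<close>

lemma qpow_imaginary: "qpow (of_real y * \<i>) (r / 2) = of_real (exp (- (pi * y * r)))"
  by (simp add: qpow_def flip: exp_of_real) (simp add: algebra_simps)

lemma theta3_imaginary:
  assumes "y > 0"
  shows "theta3 (of_real y * \<i>) = of_real (th3 (pi * y))"
proof -
  have "qpow (of_real y * \<i>) ((of_int n)\<^sup>2 / 2) = of_real (exp (- (pi * y * (of_int n)\<^sup>2)))" for n
    by (rule qpow_imaginary)
  thus ?thesis
    using has_sum_of_real[OF has_sum_th3[of "pi * y"], where 'a = complex] assms
    by (simp add: theta3_def infsumI)
qed

lemma theta2_imaginary: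
  assumes "y > 0"
  shows "theta2 (of_real y * \<i>) = of_real (th2 (pi * y))"
proof -
  have "(2 * real_of_int n + 1)\<^sup>2 / 8 = (of_int n + 1/2)\<^sup>2 / 2" for n
    by (simp add: field_simps power2_eq_square)
  hence "qpow (of_real y * \<i>) ((2 * of_int n + 1)\<^sup>2 / 8) = of_real (exp (- (pi * y * (of_int n + 1/2)\<^sup>2)))" for n
    by (simp only: qpow_imaginary)
  thus ?thesis
    using has_sum_of_real[OF has_sum_th2[of "pi * y"], where 'a = complex] assms
    by (simp add: theta2_def infsumI)
qed

lemma phi_imaginary:
  assumes "y > 0"
  shows "phi (of_real y * \<i>) = of_real (eis_theta (2 * pi * y))"
proof -
  have "2 * (of_real y * \<i>) = of_real (2 * y) * \<i>" "6 * (of_real y * \<i>) = of_real (6 * y) * \<i>" by simp_all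
  thus ?thesis
    using assms by (simp only: phi_def theta2_imaginary theta3_imaginary) (simp add: eis_theta_def mult_ac)
qed

theorem theorem5p1:
  defines "\<tau>0 \<equiv> \<i> / of_real (sqrt 3)"
  shows "phi \<tau>0 = of_real (sqrt 3 / (2 * pi) * (1 / 2 powr (1/3)) * Beta (1/3) (1/3 :: real))
       \<and> phi1 \<tau>0 = of_real (1 / (2 powr (2/3) * 3 powr (1/2)) * (1 / (2 * pi)) * Beta (1/3) (1/3 :: real))"
proof -
  define s where "s = 2 * pi / sqrt 3"
  have "phi (of_real (1 / sqrt 3) * \<i>) = of_real (eis_theta s)"
    by (subst phi_imaginary) (simp_all add: s_def)
  hence phi: "phi \<tau>0 = of_real (eis_theta s)"
    by (simp add: \<tau>0_def field_simps)
  have "phi (of_real (1 / sqrt 3 / 3) * \<i>) = of_real (eis_theta (s / 3))"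
    by (subst phi_imaginary) (simp_all add: s_def)
  hence "phi (\<tau>0 / 3) = of_real (eis_theta (s / 3))"
    by (simp add: \<tau>0_def field_simps)
  hence "phi1 \<tau>0 = of_real ((eis_theta (s / 3) - eis_theta s) / 2 / 3)"
    by (simp add: phi1_def phi)
  also have "(eis_theta (s / 3) - eis_theta s) / 2 / 3 = eis_theta s / (3 * 2 powr (1/3))"
    unfolding s_def eis_theta_singular_third by simp
  also have "\<dots> = 1 / (2 powr (2/3) * 3 powr (1/2)) * (1 / (2 * pi)) * Beta (1/3) (1/3)"
  proof -
    \<comment> \<open>One cube root of 2 comes from the value of \<open>eis_theta s\<close>, the
      other from passing to \<open>c\<close>.\<close>
    have "(2 :: real) powr (2/3) = 2 powr (1/3) * 2 powr (1/3)" by (simp flip: powr_add)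
    moreover have "eis_theta s / (3 * b) = sqrt 3 / 3 * (1 / (2 powr (1/3) * b) * (1 / (2 * pi)) * Beta (1/3) (1/3))" for b
      unfolding s_def eis_theta_singular by simp
    moreover have "sqrt 3 / 3 = 1 / (3 powr (1/2) :: real)"
      by (simp add: powr_half_sqrt real_div_sqrt field_simps)
    ultimately show ?thesis by (simp only:) simp
  qed
  finally show ?thesis
    using phi by (simp add: s_def eis_theta_singular)
qed

end
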